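(* Let $\mathfrak{V}$ be a vessel with $\sigma_1$ invertible such that for all $j,k=2,\ldots,d$: $[\sigma_1^{-1}\sigma_j,\sigma_1^{-1}\sigma_k]=0$; $[\sigma_1^{-1}\gamma_{1j},\sigma_1^{-1}\gamma_{1k}]=0$; $[\sigma_1^{-1}\sigma_k,\sigma_1^{-1}\gamma_{1j}]=[\sigma_1^{-1}\sigma_j,\sigma_1^{-1}\gamma_{1k}]$; and $\gamma_{jk}=\sigma_j\sigma_1^{-1}\gamma_{1k}-\sigma_k\sigma_1^{-1}\gamma_{1j}$. Let an initial condition $u(t_1,0,\ldots,0)=f(t_1)$ be given, where $f$ is an $\mathcal{E}$-valued function analytic near the origin of $\mathbb{R}$. Then there exist an open neighborhood of the origin in $\mathbb{R}^d$ and a unique analytic solution $u$ on it, with this initial condition, to the input compatibility system $$\sigma_k\frac{\partial u}{\partial t_j}-\sigma_j\frac{\partial u}{\partial t_k}+i\gamma_{jk}u=0,\qquad j,k=1,\ldots,d.$$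
   Context: A (Livsic commutative operator) vessel is a collection $\mathfrak{V}=(\mathcal{H},\mathcal{E},\Phi,\{A_j\},\{\sigma_j\},\{\gamma_{jk}\},\{\gamma_{*jk}\})$, where $\mathcal{H},\mathcal{E}$ are separable Hilbert spaces, $A_1,\ldots,A_d$ are commuting bounded (not necessarily selfadjoint) operators on $\mathcal{H}$, $\Phi:\mathcal{H}\to\mathcal{E}$ is bounded, and $\sigma_j,\gamma_{jk},\gamma_{*jk}$ ($j,k=1,\ldots,d$) are bounded selfadjoint operators on $\mathcal{E}$ such that for all $j,k$: $A_k-A_k^*=i\Phi^*\sigma_k\Phi$; $\gamma_{jk}=-\gamma_{kj}$, $\gamma_{*jk}=-\gamma_{*kj}$; $\sigma_j\Phi A_k^*-\sigma_k\Phi A_j^*=\gamma_{jk}\Phi$; $\sigma_j\Phi A_k-\sigma_k\Phi A_j=\gamma_{*jk}\Phi$; $\gamma_{*jk}-\gamma_{jk}=i(\sigma_j\Phi\Phi^*\sigma_k-\sigma_k\Phi\Phi^*\sigma_j)$. Analytic means strongly analytic: given near the origin by a norm-convergent power series with coefficients in $\mathcal{E}$. *)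

theory Defs
  imports "HOL-Analysis.Analysis"
begin

text \<open>The inner product is linear in the first argument. The real scalar multiplication and the
  norm of the library are tied to the complex structure, so that topology, limits, series and
  (real) derivatives are those of the library.\<close>

class complex_inner = real_normed_vector +
  fixes scaleC :: "complex \<Rightarrow> 'a \<Rightarrow> 'a" (infixr "*\<^sub>C" 75)
    and cinner :: "'a \<Rightarrow> 'a \<Rightarrow> complex"
  assumes scaleC_add_right: "c *\<^sub>C (x + y) = c *\<^sub>C x + c *\<^sub>C y"
    and scaleC_add_left: "(b + c) *\<^sub>C x = b *\<^sub>C x + c *\<^sub>C x"
    and scaleC_scaleC: "b *\<^sub>C c *\<^sub>C x = (b * c) *\<^sub>C x"
    and scaleR_scaleC: "r *\<^sub>R x = complex_of_real r *\<^sub>C x"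
    and cinner_commute: "cinner x y = cnj (cinner y x)"
    and cinner_add_left: "cinner (x + y) z = cinner x z + cinner y z"
    and cinner_scaleC_left: "cinner (c *\<^sub>C x) y = c * cinner x y"
    and cinner_self: "cinner x x = complex_of_real ((norm x)\<^sup>2)"

class chilbert_space = complex_inner + complete_space

definition bounded_clinear :: "('a::complex_inner \<Rightarrow> 'b::complex_inner) \<Rightarrow> bool" where
  "bounded_clinear T \<longleftrightarrow> bounded_linear T \<and> (\<forall>c x. T (c *\<^sub>C x) = c *\<^sub>C T x)"

text \<open>For a bounded operator between Hilbert spaces the adjoint exists by the Riesz representation
  theorem, and it is unique.\<close>

definition cadjoint :: "('a::complex_inner \<Rightarrow> 'b::complex_inner) \<Rightarrow> 'b \<Rightarrow> 'a" where
  "cadjoint T = (THE S. \<forall>x y. cinner (T x) y = cinner x (S y))"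

definition selfadjoint :: "('a::complex_inner \<Rightarrow> 'a) \<Rightarrow> bool" where
  "selfadjoint T \<longleftrightarrow> (\<forall>x y. cinner (T x) y = cinner x (T y))"

definition invertible_op :: "('a::complex_inner \<Rightarrow> 'a) \<Rightarrow> bool" where
  "invertible_op T \<longleftrightarrow> (\<exists>S. bounded_clinear S \<and> S \<circ> T = id \<and> T \<circ> S = id)"

definition op_commutator :: "('a::complex_inner \<Rightarrow> 'a) \<Rightarrow> ('a \<Rightarrow> 'a) \<Rightarrow> 'a \<Rightarrow> 'a" where
  "op_commutator S T = (\<lambda>x. S (T x) - T (S x))"

text \<open>The finite index type \<open>'d\<close> plays the role of \<open>{1, \<dots>, d}\<close>.\<close>

locale vessel =
  fixes \<Phi> :: "'h::chilbert_space \<Rightarrow> 'e::chilbert_space"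
    and A :: "'d::finite \<Rightarrow> 'h \<Rightarrow> 'h"
    and \<sigma> :: "'d \<Rightarrow> 'e \<Rightarrow> 'e"
    and \<gamma> :: "'d \<Rightarrow> 'd \<Rightarrow> 'e \<Rightarrow> 'e"
    and \<gamma>s :: "'d \<Rightarrow> 'd \<Rightarrow> 'e \<Rightarrow> 'e"
  assumes separable_H: "separable_space (euclidean :: 'h topology)"
    and separable_E: "separable_space (euclidean :: 'e topology)"
    and bounded_A: "bounded_clinear (A k)"
    and commute_A: "A j \<circ> A k = A k \<circ> A j"
    and bounded_\<Phi>: "bounded_clinear \<Phi>"
    and bounded_\<sigma>: "bounded_clinear (\<sigma> k)"
    and selfadjoint_\<sigma>: "selfadjoint (\<sigma> k)"
    and bounded_\<gamma>: "bounded_clinear (\<gamma> j k)"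
    and selfadjoint_\<gamma>: "selfadjoint (\<gamma> j k)"
    and bounded_\<gamma>s: "bounded_clinear (\<gamma>s j k)"
    and selfadjoint_\<gamma>s: "selfadjoint (\<gamma>s j k)"
    and colligation: "A k x - cadjoint (A k) x = \<i> *\<^sub>C cadjoint \<Phi> (\<sigma> k (\<Phi> x))"
    and skew_\<gamma>: "\<gamma> j k v = - \<gamma> k j v"
    and skew_\<gamma>s: "\<gamma>s j k v = - \<gamma>s k j v"
    and input_vessel_condition:
      "\<sigma> j (\<Phi> (cadjoint (A k) x)) - \<sigma> k (\<Phi> (cadjoint (A j) x)) = \<gamma> j k (\<Phi> x)"
    and output_vessel_condition:
      "\<sigma> j (\<Phi> (A k x)) - \<sigma> k (\<Phi> (A j x)) = \<gamma>s j k (\<Phi> x)"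
    and linkage:
      "\<gamma>s j k v - \<gamma> j k v =
        \<i> *\<^sub>C (\<sigma> j (\<Phi> (cadjoint \<Phi> (\<sigma> k v))) - \<sigma> k (\<Phi> (cadjoint \<Phi> (\<sigma> j v))))"

text \<open>Vector-valued power series in one and in several real variables, convergent in norm;
  multi-indices are functions \<open>'d \<Rightarrow> nat\<close>. Analyticity on a set means analyticity at
  each of its points.\<close>

definition monomial_at :: "real ^ 'd \<Rightarrow> ('d::finite \<Rightarrow> nat) \<Rightarrow> real" where
  "monomial_at t \<alpha> = (\<Prod>j\<in>UNIV. (t $ j) ^ \<alpha> j)"

definition strongly_analytic_at1 :: "(real \<Rightarrow> 'e::chilbert_space) \<Rightarrow> real \<Rightarrow> bool" where
  "strongly_analytic_at1 f a \<longleftrightarrow>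
    (\<exists>c r. r > 0 \<and> (\<forall>s\<in>ball a r. (\<lambda>n. (s - a) ^ n *\<^sub>R c n) sums f s))"

definition strongly_analytic_at :: "(real ^ 'd::finite \<Rightarrow> 'e::chilbert_space) \<Rightarrow> real ^ 'd \<Rightarrow> bool" where
  "strongly_analytic_at u a \<longleftrightarrow>
    (\<exists>c r. r > 0 \<and>
      (\<forall>t\<in>ball a r. ((\<lambda>\<alpha>. monomial_at (t - a) \<alpha> *\<^sub>R c \<alpha>) has_sum u t) UNIV))"

definition strongly_analytic_on ::
  "(real ^ 'd::finite \<Rightarrow> 'e::chilbert_space) \<Rightarrow> (real ^ 'd) set \<Rightarrow> bool" where
  "strongly_analytic_on u U \<longleftrightarrow> (\<forall>a\<in>U. strongly_analytic_at u a)"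

text \<open>The partial derivative with respect to the coordinate \<open>j\<close>; a junk value if it does not exist,
  but it is only used for analytic functions.\<close>

definition partial_deriv ::
  "(real ^ 'd::finite \<Rightarrow> 'e::chilbert_space) \<Rightarrow> 'd \<Rightarrow> real ^ 'd \<Rightarrow> 'e" where
  "partial_deriv u j t = vector_derivative (\<lambda>s. u (t + axis j s)) (at 0)"

definition input_system_on ::
  "('d::finite \<Rightarrow> 'e::chilbert_space \<Rightarrow> 'e) \<Rightarrow> ('d \<Rightarrow> 'd \<Rightarrow> 'e \<Rightarrow> 'e) \<Rightarrow>
    (real ^ 'd) set \<Rightarrow> (real ^ 'd \<Rightarrow> 'e) \<Rightarrow> bool" where
  "input_system_on \<sigma> \<gamma> U u \<longleftrightarrow>
    (\<forall>t\<in>U. \<forall>j k.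
      \<sigma> k (partial_deriv u j t) - \<sigma> j (partial_deriv u k t) + \<i> *\<^sub>C \<gamma> j k (u t) = 0)"

text \<open>The initial condition is \<open>u(t\<^sub>1, 0, \<dots>, 0) = f(t\<^sub>1)\<close>, with \<open>e\<close> in the role of the index 1.\<close>

definition analytic_solution_on ::
  "('d::finite \<Rightarrow> 'e::chilbert_space \<Rightarrow> 'e) \<Rightarrow> ('d \<Rightarrow> 'd \<Rightarrow> 'e \<Rightarrow> 'e) \<Rightarrow> 'd \<Rightarrow>
    (real \<Rightarrow> 'e) \<Rightarrow> (real ^ 'd) set \<Rightarrow> (real ^ 'd \<Rightarrow> 'e) \<Rightarrow> bool" where
  "analytic_solution_on \<sigma> \<gamma> e f U u \<longleftrightarrow>
    strongly_analytic_on u U \<and> input_system_on \<sigma> \<gamma> U u \<and>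
    (\<forall>s. axis e s \<in> U \<longrightarrow> u (axis e s) = f s)"

end

theory Submission
  imports Defs
begin

text \<open>With \<open>P\<^sub>k = \<sigma>\<^sub>1\<^sup>-\<^sup>1 \<sigma>\<^sub>k\<close> and \<open>Q\<^sub>k = i \<sigma>\<^sub>1\<^sup>-\<^sup>1 \<gamma>\<^sub>1\<^sub>k\<close> the system is equivalent to
  \<open>\<partial>u/\<partial>t\<^sub>k = P\<^sub>k \<partial>u/\<partial>t\<^sub>1 + Q\<^sub>k u\<close> for all \<open>k\<close>, and the commutator hypotheses say exactly that the
  operators \<open>L\<^sub>k = P\<^sub>k \<partial>/\<partial>t\<^sub>1 + Q\<^sub>k\<close> commute. So the coefficient of \<open>t\<^sup>\<alpha>\<close> must be
  \<open>(L\<^sup>\<alpha> f)(0) / \<alpha>!\<close>; it grows at most geometrically in \<open>|\<alpha>|\<close>, so the series converges near 0 and,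
  being re-expandable at nearby points, is analytic there. The recursion determines all Taylor
  coefficients at 0, and analytic continuation along segments gives uniqueness on a ball.\<close>

section \<open>Vector-valued power series in one variable\<close>

\<comment> \<open>Write D for differentiation in t_1. The commutator of \<open>L j\<close> and
  \<open>L k\<close> has the coefficients [P_j,P_k] of D^2, [P_j,Q_k] - [P_k,Q_j] of D, and
  [Q_j,Q_k]; the first three hypotheses annihilate one each. Commutation makes
  \<open>L^\<alpha>\<close> independent of the order of its factors, so the recursions in the
  different directions are compatible. The fourth hypothesis, with the commuting P_k, makes the
  equations of all pairs (j,k) follow from those of the pairs (1,k).

  The obstacle to convergence is that every L_k differentiates. The loss after |\<alpha>| steps is a
  factorial |\<alpha>|!, and division by \<alpha>! leaves the multinomial coefficient, at most
  d^|\<alpha>|.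

  The factor i is absorbed into Q_k, so the first-order system is treated with real-linear operators
  and real power series throughout. A competing solution is only known to have some expansion at
  each point, with no control on the radii; this is why the comparison of coefficients at 0 does not
  settle uniqueness on the whole ball by itself.\<close>
subclass (in chilbert_space) banach ..

lemma sums_imp_coeff_bound:
  fixes b :: "nat \<Rightarrow> 'a::real_normed_vector"
  assumes "q > 0" "(\<lambda>n. q ^ n *\<^sub>R b n) sums S"
  obtains M where "M > 0" "\<And>n. norm (b n) \<le> M / q ^ n"
proof -
  have "(\<lambda>n. q ^ n *\<^sub>R b n) \<longlonglongrightarrow> 0"
    using assms by (auto intro: summable_LIMSEQ_zero sums_summable)
  then have "Bseq (\<lambda>n. q ^ n *\<^sub>R b n)"
    by (intro convergent_imp_Bseq) (auto simp: convergent_def)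
  then obtain M where "M > 0" and M: "\<And>n. norm (q ^ n *\<^sub>R b n) \<le> M"
    by (auto simp: Bseq_def)
  have "norm (b n) \<le> M / q ^ n" for n
    using M[of n] assms(1) by (simp add: field_simps)
  then show ?thesis using that \<open>M > 0\<close> by blast
qed

text \<open>The one estimate behind the facts on one variable: the terms are bounded at q < r, so
  for |s| \<le> q/2 the tail after \<open>b 0\<close> is |s| times a geometric series of ratio 1/2.
  The derivative and the identity theorem follow by applying this to the series divided by
  s.\<close>

lemma vector_powser_tendsto:
  fixes b :: "nat \<Rightarrow> 'a::banach"
  assumes "r > 0" and sums: "\<And>s. \<bar>s\<bar> < r \<Longrightarrow> (\<lambda>n. s ^ n *\<^sub>R b n) sums \<phi> s"
  shows "(\<phi> \<longlongrightarrow> b 0) (at 0)"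
proof -
  define q where "q = r / 2"
  have q: "q > 0" "q < r" using \<open>r > 0\<close> by (auto simp: q_def)
  obtain M where "M > 0" and b: "\<And>n. norm (b n) \<le> M / q ^ n"
    by (rule sums_imp_coeff_bound[OF q(1) sums[of q]]) (use q in auto)
  have bound: "norm (\<phi> s - b 0) \<le> \<bar>s\<bar> * (2 * M / q)" if "\<bar>s\<bar> \<le> q / 2" for s
  proof -
    have "(\<lambda>n. s ^ Suc n *\<^sub>R b (Suc n)) sums (\<phi> s - s ^ 0 *\<^sub>R b 0)"
      using that q by (subst sums_Suc_iff) (auto intro!: sums)
    then have eq: "\<phi> s - b 0 = (\<Sum>n. s ^ Suc n *\<^sub>R b (Suc n))"
      by (simp add: sums_iff)
    have le: "norm (s ^ Suc n *\<^sub>R b (Suc n)) \<le> \<bar>s\<bar> * (M / q) * (1 / 2) ^ n" for n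
    proof -
      have "norm (s ^ Suc n *\<^sub>R b (Suc n)) \<le> \<bar>s\<bar> ^ Suc n * (M / q ^ Suc n)"
        unfolding norm_scaleR power_abs[symmetric] by (intro mult_mono b) (auto simp: power_abs)
      also have "\<dots> = \<bar>s\<bar> * (M / q) * (\<bar>s\<bar> / q) ^ n"
        by (simp add: power_divide)
      also have "\<dots> \<le> \<bar>s\<bar> * (M / q) * (1 / 2) ^ n"
        using that q \<open>M > 0\<close> by (intro mult_left_mono power_mono) (auto simp: field_simps)
      finally show ?thesis .
    qed
    have geo: "summable (\<lambda>n. \<bar>s\<bar> * (M / q) * (1 / 2 :: real) ^ n)"
      by (intro summable_mult summable_geometric) auto
    have "norm (\<phi> s - b 0) \<le> (\<Sum>n. \<bar>s\<bar> * (M / q) * (1 / 2) ^ n)"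
      unfolding eq by (rule norm_suminf_le[OF le geo])
    also have "\<dots> = \<bar>s\<bar> * (2 * M / q)"
      by (subst suminf_mult) (auto intro: summable_geometric simp: suminf_geometric summable_geometric)
    finally show ?thesis .
  qed
  have lim: "((\<lambda>s. \<bar>s\<bar> * (2 * M / q)) \<longlongrightarrow> 0) (at 0)"
    using q by (auto intro!: tendsto_eq_intros)
  have "((\<lambda>s. \<phi> s - b 0) \<longlongrightarrow> 0) (at 0)"
  proof (rule Lim_null_comparison[OF _ lim])
    show "\<forall>\<^sub>F s in at 0. norm (\<phi> s - b 0) \<le> \<bar>s\<bar> * (2 * M / q)"
      unfolding eventually_at using bound q
      by (intro exI[of _ "q / 2"]) (auto simp: dist_real_def)
  qed
  then show ?thesis using Lim_null by blast
qed

lemma vector_powser_shift: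
  fixes b :: "nat \<Rightarrow> 'a::banach"
  assumes "(\<lambda>n. s ^ n *\<^sub>R b n) sums \<phi>" "s \<noteq> 0"
  shows "(\<lambda>n. s ^ n *\<^sub>R b (Suc n)) sums ((1 / s) *\<^sub>R (\<phi> - b 0))"
proof -
  have "(\<lambda>n. s ^ Suc n *\<^sub>R b (Suc n)) sums (\<phi> - s ^ 0 *\<^sub>R b 0)"
    using assms by (subst sums_Suc_iff) auto
  from sums_scaleR_right[OF this, of "1 / s"] show ?thesis
    using \<open>s \<noteq> 0\<close> by simp
qed

text \<open>Filling in \<open>b 1\<close> at s = 0 makes the difference quotient the sum of a power
  series on the whole interval, so that results on power series apply to it again.\<close>

lemma vector_powser_shift_all:
  fixes b :: "nat \<Rightarrow> 'a::banach"
  assumes "\<And>s. \<bar>s\<bar> < r \<Longrightarrow> (\<lambda>n. s ^ n *\<^sub>R b n) sums \<phi> s" "\<bar>s\<bar> < r"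
  shows "(\<lambda>n. s ^ n *\<^sub>R b (Suc n)) sums
    (if s = 0 then b 1 else (1 / s) *\<^sub>R (\<phi> s - b 0))"
proof (cases "s = 0")
  case True
  have "(\<lambda>n. (0::real) ^ n *\<^sub>R b (Suc n)) sums (\<Sum>n\<in>{0}. (0::real) ^ n *\<^sub>R b (Suc n))"
    by (rule sums_finite) auto
  then show ?thesis by (simp add: True)
next
  case False
  then show ?thesis using vector_powser_shift[OF assms(1)[OF assms(2)]] by simp
qed

text \<open>The difference quotient is the sum of the shifted series, and its limit at 0 is the
  constant term of that series.\<close>

lemma vector_powser_has_vector_derivative:
  fixes b :: "nat \<Rightarrow> 'a::banach"
  assumes "r > 0" and sums: "\<And>s. \<bar>s\<bar> < r \<Longrightarrow> (\<lambda>n. s ^ n *\<^sub>R b n) sums \<phi> s"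
  shows "(\<phi> has_vector_derivative b 1) (at 0)"
proof -
  have "(\<lambda>n. (0::real) ^ n *\<^sub>R b n) sums (\<Sum>n\<in>{0}. (0::real) ^ n *\<^sub>R b n)"
    by (rule sums_finite) auto
  then have \<phi>0: "\<phi> 0 = b 0"
    using sums[of 0] \<open>r > 0\<close> by (auto intro: sums_unique2)
  have "((\<lambda>s. if s = 0 then b 1 else (1 / s) *\<^sub>R (\<phi> s - b 0)) \<longlongrightarrow> (\<lambda>n. b (Suc n)) 0) (at 0)"
    by (rule vector_powser_tendsto[OF \<open>r > 0\<close> vector_powser_shift_all[OF sums]])
  then have "((\<lambda>s. (1 / s) *\<^sub>R (\<phi> s - b 0)) \<longlongrightarrow> b 1) (at 0)"
    unfolding One_nat_def by (rule Lim_transform_eventually) (auto simp: eventually_at_filter)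
  then have "((\<lambda>s. norm ((1 / s) *\<^sub>R (\<phi> s - b 0) - b 1)) \<longlongrightarrow> 0) (at 0)"
    using Lim_null tendsto_norm_zero by blast
  moreover have "norm ((1 / s) *\<^sub>R (\<phi> s - b 0) - b 1) = norm (\<phi> (0 + s) - \<phi> 0 - s *\<^sub>R b 1) / norm s"
    if "s \<noteq> 0" for s
  proof -
    have "(1 / s) *\<^sub>R (\<phi> s - b 0) - b 1 = (1 / s) *\<^sub>R (\<phi> s - \<phi> 0 - s *\<^sub>R b 1)"
      using that by (simp add: \<phi>0 scaleR_diff_right)
    then show ?thesis by simp
  qed
  ultimately have "((\<lambda>s. norm (\<phi> (0 + s) - \<phi> 0 - s *\<^sub>R b 1) / norm s) \<longlongrightarrow> 0) (at 0)"
    by (elim Lim_transform_eventually) (auto simp: eventually_at_filter)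
  then show ?thesis
    unfolding has_vector_derivative_def has_derivative_at
    by (auto intro: bounded_linear_scaleR_left)
qed

text \<open>It is enough that zeros accumulate at 0: a nonzero constant term would keep the sum away
  from 0 nearby, and once it is 0, division by s keeps the zeros. This weak hypothesis is what a
  limit point of zeros provides in \<open>strongly_analytic_vanish\<close>.\<close>

lemma vector_powser_coeffs_zero:
  fixes b :: "nat \<Rightarrow> 'a::banach"
  assumes "r > 0" and sums: "\<And>s. \<bar>s\<bar> < r \<Longrightarrow> (\<lambda>n. s ^ n *\<^sub>R b n) sums \<phi> s"
    and "\<exists>\<^sub>F s in at 0. \<phi> s = 0"
  shows "b n = 0"
  using sums assms(3)
proof (induction n arbitrary: b \<phi>)
  have first: "b 0 = 0"
    if sums: "\<And>s. \<bar>s\<bar> < r \<Longrightarrow> (\<lambda>n. s ^ n *\<^sub>R b n) sums \<phi> s" 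
    and freq: "\<exists>\<^sub>F s in at 0. \<phi> s = 0" for b :: "nat \<Rightarrow> 'a" and \<phi>
  proof (rule ccontr)
    assume "b 0 \<noteq> 0"
    then have "\<forall>\<^sub>F s in at 0. \<phi> s \<noteq> 0"
      using vector_powser_tendsto[OF \<open>r > 0\<close> sums] tendsto_imp_eventually_ne by blast
    then show False using freq by (simp add: frequently_def)
  qed
  {
    case 0
    then show ?case using first by blast
  next
    case (Suc n)
    have b0: "b 0 = 0" using first Suc.prems by blast
    have "\<exists>\<^sub>F s in at 0. (if s = 0 then b 1 else (1 / s) *\<^sub>R (\<phi> s - b 0)) = 0"
      using Suc.prems(2)
      by (rule frequently_rev_mp) (auto simp: b0 eventually_at_filter)
    from Suc.IH[OF vector_powser_shift_all[OF Suc.prems(1)] this] show ?case by auto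
  }
qed

section \<open>Power series indexed by multi-indices\<close>

abbreviation deg :: "('d::finite \<Rightarrow> nat) \<Rightarrow> nat" where
  "deg \<alpha> \<equiv> sum \<alpha> UNIV"

definition bump :: "'d \<Rightarrow> ('d \<Rightarrow> nat) \<Rightarrow> 'd \<Rightarrow> nat" where
  "bump j \<alpha> = \<alpha>(j := Suc (\<alpha> j))"

lemma bump_apply: "bump j \<alpha> i = (if i = j then Suc (\<alpha> j) else \<alpha> i)"
  by (simp add: bump_def)

lemma deg_bump [simp]: "deg (bump j \<alpha>) = Suc (deg \<alpha>)"
proof -
  have "deg (bump j \<alpha>) = (\<Sum>i\<in>UNIV. \<alpha> i + (if i = j then 1 else 0))"
    by (intro sum.cong) (auto simp: bump_apply)
  then show ?thesis by (simp add: sum.distrib)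
qed

lemma bump_decr: "0 < \<alpha> j \<Longrightarrow> bump j (\<alpha>(j := \<alpha> j - 1)) = \<alpha>"
  by (auto simp: bump_def)

lemma inj_bump: "inj (bump j)"
  by (rule injI) (metis bump_def fun_upd_idem_iff fun_upd_same fun_upd_upd nat.inject)

lemma range_bump: "range (bump j) = {\<alpha>. 0 < \<alpha> j}"
proof (intro equalityI subsetI)
  fix \<alpha> :: "_ \<Rightarrow> nat" assume "\<alpha> \<in> {\<alpha>. 0 < \<alpha> j}"
  then have "\<alpha> = bump j (\<alpha>(j := \<alpha> j - 1))" using bump_decr[of \<alpha> j] by simp
  then show "\<alpha> \<in> range (bump j)" by (intro range_eqI[of _ "bump j"])
qed (auto simp: bump_apply)

lemma deg_Suc_obtain:
  assumes "deg \<alpha> = Suc n"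
  obtains j \<beta> where "\<alpha> = bump j \<beta>" "deg \<beta> = n"
proof -
  obtain j where "\<alpha> j > 0"
    using assms by (metis gr0I nat.simps(3) sum.neutral)
  then have "\<alpha> = bump j (\<alpha>(j := \<alpha> j - 1))" by (rule bump_decr[symmetric])
  then show ?thesis using that assms deg_bump by (metis nat.inject)
qed

lemma finite_deg: "finite {\<alpha> :: 'd::finite \<Rightarrow> nat. deg \<alpha> = n}"
proof (rule finite_subset)
  show "{\<alpha> :: 'd \<Rightarrow> nat. deg \<alpha> = n} \<subseteq> PiE UNIV (\<lambda>_. {..n})"
    by (auto simp: PiE_UNIV_domain member_le_sum)
qed (auto intro: finite_PiE)

lemma abs_monomial_at: "\<bar>monomial_at t \<alpha>\<bar> = (\<Prod>j\<in>UNIV. \<bar>t $ j\<bar> ^ \<alpha> j)"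
  by (simp add: monomial_at_def abs_prod power_abs)

lemma prod_power_deg: "(\<Prod>j\<in>UNIV. (c * x j) ^ \<alpha> j) = c ^ deg \<alpha> * (\<Prod>j\<in>UNIV. x j ^ \<alpha> j)"
  for c :: real
  by (simp add: power_mult_distrib prod.distrib power_sum)

lemma monomial_at_scaleR: "monomial_at (s *\<^sub>R t) \<alpha> = s ^ deg \<alpha> * monomial_at t \<alpha>"
  unfolding monomial_at_def by (simp add: prod_power_deg)

lemma monomial_at_axis:
  "monomial_at (axis j 1) \<alpha> = (if \<forall>i. i \<noteq> j \<longrightarrow> \<alpha> i = 0 then 1 else 0)"
  unfolding monomial_at_def axis_def by (auto simp: zero_power prod_zero_iff intro!: prod.neutral)

text \<open>A finite set of multi-indices lies in a box, and the sum over a box factors into a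
  product of one-variable geometric sums.\<close>

lemma summable_multi_geometric:
  fixes x :: "'d::finite \<Rightarrow> real"
  assumes "\<And>j. 0 \<le> x j" "\<And>j. x j < 1"
  shows "(\<lambda>\<alpha>. \<Prod>j\<in>UNIV. x j ^ \<alpha> j) summable_on UNIV"
proof (rule nonneg_bdd_above_summable_on)
  show "0 \<le> (\<Prod>j\<in>UNIV. x j ^ \<alpha> j)" for \<alpha>
    by (intro prod_nonneg) (auto simp: assms)
  show "bdd_above (sum (\<lambda>\<alpha>. \<Prod>j\<in>UNIV. x j ^ \<alpha> j) ` {F. F \<subseteq> UNIV \<and> finite F})"
  proof (rule bdd_aboveI2)
    fix F :: "('d \<Rightarrow> nat) set" assume F: "F \<in> {F. F \<subseteq> UNIV \<and> finite F}"
    define N where "N = Max (insert 0 (deg ` F))"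
    have N: "\<alpha> j \<le> N" if "\<alpha> \<in> F" for \<alpha> j
    proof -
      have "\<alpha> j \<le> deg \<alpha>" by (simp add: member_le_sum)
      also have "\<dots> \<le> N" unfolding N_def using F that by (intro Max_ge) auto
      finally show ?thesis .
    qed
    have "(\<Sum>\<alpha>\<in>F. \<Prod>j\<in>UNIV. x j ^ \<alpha> j) \<le> (\<Sum>\<alpha>\<in>PiE UNIV (\<lambda>_. {..N}). \<Prod>j\<in>UNIV. x j ^ \<alpha> j)"
      using N by (intro sum_mono2 prod_nonneg)
        (auto simp: assms intro: finite_PiE)
    also have "\<dots> = (\<Prod>j\<in>UNIV. \<Sum>n\<le>N. x j ^ n)"
      by (rule prod_sum_PiE[symmetric]) auto
    also have "\<dots> \<le> (\<Prod>j\<in>UNIV. 1 / (1 - x j))"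
    proof (intro prod_mono conjI)
      fix j
      show "0 \<le> (\<Sum>n\<le>N. x j ^ n)" by (intro sum_nonneg) (auto simp: assms)
      have "(\<Sum>n\<le>N. x j ^ n) \<le> (\<Sum>n. x j ^ n)"
        using assms by (intro sum_le_suminf summable_geometric) auto
      also have "\<dots> = 1 / (1 - x j)"
        using assms by (intro suminf_geometric) auto
      finally show "(\<Sum>n\<le>N. x j ^ n) \<le> 1 / (1 - x j)" .
    qed
    finally show "(\<Sum>\<alpha>\<in>F. \<Prod>j\<in>UNIV. x j ^ \<alpha> j) \<le> (\<Prod>j\<in>UNIV. 1 / (1 - x j))" .
  qed
qed

text \<open>Geometric growth of the coefficients is the hypothesis under which power series are
  manipulated: unconditional convergence on a ball implies it, and it gives absolute convergence
  on a smaller polydisc.\<close>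

definition geometric_bound :: "real \<Rightarrow> real \<Rightarrow> (('d::finite \<Rightarrow> nat) \<Rightarrow> 'a::real_normed_vector) \<Rightarrow> bool" where
  "geometric_bound M \<rho> c \<longleftrightarrow> 0 < M \<and> 0 < \<rho> \<and> (\<forall>\<alpha>. norm (c \<alpha>) \<le> M * \<rho> ^ deg \<alpha>)"

definition mpower_series :: "(('d::finite \<Rightarrow> nat) \<Rightarrow> 'a::real_normed_vector) \<Rightarrow> real ^ 'd \<Rightarrow> 'a" where
  "mpower_series c t = (\<Sum>\<^sub>\<infinity>\<alpha>. monomial_at t \<alpha> *\<^sub>R c \<alpha>)"

lemma geometric_bound_abs_summable:
  assumes "geometric_bound M \<rho> c" "\<And>j. \<rho> * \<bar>t $ j\<bar> < 1"
  shows "(\<lambda>\<alpha>. norm (monomial_at t \<alpha> *\<^sub>R c \<alpha>)) summable_on UNIV"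
proof (rule Infinite_Sum.abs_summable_on_comparison_test')
  have "(\<lambda>\<alpha>. \<Prod>j\<in>UNIV. (\<rho> * \<bar>t $ j\<bar>) ^ \<alpha> j) summable_on UNIV"
    using assms by (intro summable_multi_geometric) (auto simp: geometric_bound_def)
  then show "(\<lambda>\<alpha>. M * (\<Prod>j\<in>UNIV. (\<rho> * \<bar>t $ j\<bar>) ^ \<alpha> j)) summable_on UNIV"
    by (rule summable_on_cmult_right)
  show "norm (monomial_at t \<alpha> *\<^sub>R c \<alpha>) \<le> M * (\<Prod>j\<in>UNIV. (\<rho> * \<bar>t $ j\<bar>) ^ \<alpha> j)" for \<alpha>
  proof -
    have "norm (monomial_at t \<alpha> *\<^sub>R c \<alpha>) \<le> \<bar>monomial_at t \<alpha>\<bar> * (M * \<rho> ^ deg \<alpha>)"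
      using assms by (simp add: geometric_bound_def mult_left_mono)
    then show ?thesis by (simp add: prod_power_deg abs_monomial_at mult_ac)
  qed
qed

lemma geometric_bound_has_sum:
  fixes c :: "('d::finite \<Rightarrow> nat) \<Rightarrow> 'a::banach"
  assumes "geometric_bound M \<rho> c" "\<And>j. \<rho> * \<bar>t $ j\<bar> < 1"
  shows "((\<lambda>\<alpha>. monomial_at t \<alpha> *\<^sub>R c \<alpha>) has_sum mpower_series c t) UNIV"
  unfolding mpower_series_def
  by (rule has_sum_infsum[OF Infinite_Sum.abs_summable_summable[OF geometric_bound_abs_summable[OF assms]]])

text \<open>Beyond a finite set X all partial sums are within 1 of S. For i outside X,
  \<open>g i\<close> is the difference of the partial sums over \<open>insert i X\<close> and X, so
  its norm is at most 2.\<close>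

lemma has_sum_imp_bounded:
  fixes g :: "'i \<Rightarrow> 'a::real_normed_vector"
  assumes "(g has_sum S) A"
  obtains M where "M > 0" "\<And>i. i \<in> A \<Longrightarrow> norm (g i) \<le> M"
proof -
  have "\<forall>\<^sub>F F in finite_subsets_at_top A. dist (sum g F) S < 1"
    using assms unfolding has_sum_def tendsto_iff by simp
  then obtain X where X: "finite X" "X \<subseteq> A"
    and near: "\<And>Y. finite Y \<Longrightarrow> X \<subseteq> Y \<Longrightarrow> Y \<subseteq> A \<Longrightarrow> dist (sum g Y) S < 1"
    unfolding eventually_finite_subsets_at_top by metis
  define M where "M = 2 + (\<Sum>i\<in>X. norm (g i))"
  have "norm (g i) \<le> M" if "i \<in> A" for i
  proof (cases "i \<in> X")
    case True
    then have "norm (g i) \<le> (\<Sum>i\<in>X. norm (g i))"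
      using X by (intro member_le_sum) auto
    then show ?thesis by (simp add: M_def)
  next
    case False
    then have "g i = (sum g (insert i X) - S) - (sum g X - S)"
      using X by simp
    then have "norm (g i) \<le> dist (sum g (insert i X)) S + dist (sum g X) S"
      unfolding dist_norm by (metis norm_triangle_ineq4)
    also have "\<dots> \<le> 2"
      using near[of "insert i X"] near[of X] X that by fastforce
    finally show ?thesis
      unfolding M_def by (smt (verit) norm_ge_zero sum_nonneg)
  qed
  moreover have "M > 0"
    unfolding M_def by (smt (verit) norm_ge_zero sum_nonneg)
  ultimately show ?thesis using that by blast
qed

text \<open>A single test point suffices: at a diagonal point (q, ..., q) the monomial of index
  \<alpha> equals q^|\<alpha>|, so bounded terms there mean geometric growth of rate 1/q.\<close>

lemma has_sum_imp_geometric_bound: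
  fixes c :: "('d::finite \<Rightarrow> nat) \<Rightarrow> 'a::real_normed_vector"
  assumes "r > 0"
    and sums: "\<And>h. h \<in> ball (0 :: real ^ 'd) r \<Longrightarrow>
      ((\<lambda>\<alpha>. monomial_at h \<alpha> *\<^sub>R c \<alpha>) has_sum w h) UNIV"
  obtains M \<rho> where "geometric_bound M \<rho> c"
proof -
  \<comment> \<open>This makes the l1 norm of the diagonal point r/2, which keeps it inside the
    Euclidean ball.\<close>
  define q where "q = r / (2 * CARD('d))"
  have q: "q > 0" using \<open>r > 0\<close> by (simp add: q_def)
  define h :: "real ^ 'd" where "h = (\<chi> j. q)"
  have "norm h \<le> (\<Sum>j\<in>UNIV. \<bar>h $ j\<bar>)" by (rule norm_le_l1_cart)
  also have "\<dots> = r / 2" using \<open>r > 0\<close> by (simp add: h_def q_def)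
  finally have "h \<in> ball 0 r" using \<open>r > 0\<close> by simp
  from has_sum_imp_bounded[OF sums[OF this]] obtain M where "M > 0"
    and M: "\<And>\<alpha>. norm (monomial_at h \<alpha> *\<^sub>R c \<alpha>) \<le> M" by auto
  have "monomial_at h \<alpha> = q ^ deg \<alpha>" for \<alpha>
    by (simp add: monomial_at_def h_def power_sum)
  then have "norm (c \<alpha>) \<le> M * (1 / q) ^ deg \<alpha>" for \<alpha>
    using M[of \<alpha>] q by (simp add: field_simps power_one_over)
  then have "geometric_bound M (1 / q) c"
    using q \<open>M > 0\<close> by (simp add: geometric_bound_def)
  then show ?thesis by (rule that)
qed

lemma strongly_analytic_atE:
  fixes u :: "real ^ 'd::finite \<Rightarrow> 'e::chilbert_space"
  assumes "strongly_analytic_at u a"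
  obtains c r M \<rho> where "r > 0" "geometric_bound M \<rho> c"
    "\<And>h. h \<in> ball 0 r \<Longrightarrow> ((\<lambda>\<alpha>. monomial_at h \<alpha> *\<^sub>R c \<alpha>) has_sum u (a + h)) UNIV"
proof -
  obtain c r where "r > 0"
    and *: "\<And>t. t \<in> ball a r \<Longrightarrow> ((\<lambda>\<alpha>. monomial_at (t - a) \<alpha> *\<^sub>R c \<alpha>) has_sum u t) UNIV"
    using assms unfolding strongly_analytic_at_def by blast
  have sums: "((\<lambda>\<alpha>. monomial_at h \<alpha> *\<^sub>R c \<alpha>) has_sum u (a + h)) UNIV" if "h \<in> ball 0 r" for h
    using *[of "a + h"] that by (simp add: dist_norm)
  obtain M \<rho> where "geometric_bound M \<rho> c"
    using has_sum_imp_geometric_bound[OF \<open>r > 0\<close> sums] by blast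
  then show ?thesis using that \<open>r > 0\<close> sums by blast
qed

text \<open>The value at t of the homogeneous part of degree n, that is, the coefficient of s^n in
  the series restricted to the line s t.\<close>

definition line_coeff ::
  "(('d::finite \<Rightarrow> nat) \<Rightarrow> 'a::real_normed_vector) \<Rightarrow> real ^ 'd \<Rightarrow> nat \<Rightarrow> 'a" where
  "line_coeff c t n = (\<Sum>\<alpha> | deg \<alpha> = n. monomial_at t \<alpha> *\<^sub>R c \<alpha>)"

text \<open>Unconditional convergence permits grouping the multi-indices by degree, and each group
  is finite.\<close>

lemma line_coeff_sums:
  fixes c :: "('d::finite \<Rightarrow> nat) \<Rightarrow> 'a::real_normed_vector"
  assumes "((\<lambda>\<alpha>. monomial_at (s *\<^sub>R t) \<alpha> *\<^sub>R c \<alpha>) has_sum S) UNIV"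
  shows "(\<lambda>n. s ^ n *\<^sub>R line_coeff c t n) sums S"
proof (rule has_sum_imp_sums)
  define D where "D n = {\<alpha> :: 'd \<Rightarrow> nat. deg \<alpha> = n}" for n
  have bij: "bij_betw (snd :: nat \<times> ('d \<Rightarrow> nat) \<Rightarrow> _) (Sigma UNIV D) UNIV"
    by (rule bij_betw_byWitness[where f' = "\<lambda>\<alpha>. (deg \<alpha>, \<alpha>)"]) (auto simp: D_def)
  have "((\<lambda>p. monomial_at (s *\<^sub>R t) (snd p) *\<^sub>R c (snd p)) has_sum S) (Sigma UNIV D)"
    using has_sum_reindex_bij_betw[OF bij, of "\<lambda>\<alpha>. monomial_at (s *\<^sub>R t) \<alpha> *\<^sub>R c \<alpha>" S] assms
    by simp
  moreover have "((\<lambda>\<alpha>. monomial_at (s *\<^sub>R t) (snd (n, \<alpha>)) *\<^sub>R c (snd (n, \<alpha>))) has_sum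
      s ^ n *\<^sub>R line_coeff c t n) (D n)" for n
    unfolding line_coeff_def scaleR_sum_right
    by (intro has_sum_finiteI) (auto simp: D_def finite_deg monomial_at_scaleR intro!: sum.cong)
  ultimately show "((\<lambda>n. s ^ n *\<^sub>R line_coeff c t n) has_sum S) UNIV"
    by (rule has_sum_SigmaD[where f = "\<lambda>p. monomial_at (s *\<^sub>R t) (snd p) *\<^sub>R c (snd p)"])
qed

text \<open>On a coordinate axis only pure powers survive. The case n = 1 gives partial derivatives;
  the axis of \<open>e\<close> gives the initial condition.\<close>

lemma line_coeff_axis:
  "line_coeff c (axis j 1) n = c (\<lambda>i. if i = j then n else 0)"
proof -
  have "(deg \<alpha> = n \<and> (\<forall>i. i \<noteq> j \<longrightarrow> \<alpha> i = 0)) \<longleftrightarrow> \<alpha> = (\<lambda>i. if i = j then n else 0)" for \<alpha>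
  proof
    assume *: "deg \<alpha> = n \<and> (\<forall>i. i \<noteq> j \<longrightarrow> \<alpha> i = 0)"
    then have "deg \<alpha> = (\<Sum>i\<in>UNIV. if i = j then \<alpha> j else 0)"
      by (intro sum.cong) auto
    with * show "\<alpha> = (\<lambda>i. if i = j then n else 0)" by auto
  qed auto
  then have set_eq: "{\<alpha>. deg \<alpha> = n} \<inter> {\<alpha>. \<forall>i. i \<noteq> j \<longrightarrow> \<alpha> i = 0} = {\<lambda>i. if i = j then n else 0}"
    unfolding Int_def mem_Collect_eq singleton_conv[symmetric] by (intro Collect_cong) simp
  have "line_coeff c (axis j 1) n =
      (\<Sum>\<alpha>\<in>{\<alpha>. deg \<alpha> = n}. if \<alpha> \<in> {\<alpha>. \<forall>i. i \<noteq> j \<longrightarrow> \<alpha> i = 0} then c \<alpha> else 0)"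
    unfolding line_coeff_def by (intro sum.cong) (auto simp: monomial_at_axis)
  also have "\<dots> = sum c ({\<alpha>. deg \<alpha> = n} \<inter> {\<alpha>. \<forall>i. i \<noteq> j \<longrightarrow> \<alpha> i = 0})"
    by (rule sum.inter_restrict[OF finite_deg, symmetric])
  finally show ?thesis by (simp add: set_eq)
qed

section \<open>Recentering and termwise differentiation\<close>

lemma axis_eq_scaleR: "axis j s = s *\<^sub>R (axis j 1 :: real ^ 'd::finite)"
  by (simp add: vec_eq_iff axis_def)

text \<open>The coefficient of x^\<beta> in (y + x)^\<alpha>. If some \<beta>_j exceeds \<alpha>_j,
  the binomial coefficient is 0, so the truncated subtraction in the exponent does no harm.\<close>

definition binomial_weight :: "('d::finite \<Rightarrow> real) \<Rightarrow> ('d \<Rightarrow> nat) \<Rightarrow> ('d \<Rightarrow> nat) \<Rightarrow> real" where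
  "binomial_weight y \<alpha> \<beta> = (\<Prod>j\<in>UNIV. real (\<alpha> j choose \<beta> j) * y j ^ (\<alpha> j - \<beta> j))"

lemma multi_binomial:
  fixes x y :: "'d::finite \<Rightarrow> real"
  shows "((\<lambda>\<beta>. (\<Prod>j\<in>UNIV. x j ^ \<beta> j) * binomial_weight y \<alpha> \<beta>) has_sum
    (\<Prod>j\<in>UNIV. (y j + x j) ^ \<alpha> j)) UNIV"
proof (rule has_sum_finite_neutralI)
  let ?B = "PiE UNIV (\<lambda>j. {..\<alpha> j})"
  show "finite ?B" by (intro finite_PiE) auto
  show "(\<Prod>j\<in>UNIV. x j ^ \<beta> j) * binomial_weight y \<alpha> \<beta> = 0" if "\<beta> \<in> UNIV - ?B" for \<beta>
  proof -
    have "\<not> (\<forall>j. \<beta> j \<le> \<alpha> j)" using that by (auto simp: PiE_UNIV_domain)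
    then obtain j where "\<alpha> j < \<beta> j" by (auto simp: not_le)
    then have "real (\<alpha> j choose \<beta> j) * y j ^ (\<alpha> j - \<beta> j) = 0" by simp
    then have "binomial_weight y \<alpha> \<beta> = 0"
      unfolding binomial_weight_def by (intro prod_zero bexI[of _ j]) simp_all
    then show ?thesis by simp
  qed
  have "(\<Prod>j\<in>UNIV. (y j + x j) ^ \<alpha> j)
      = (\<Prod>j\<in>UNIV. \<Sum>k\<le>\<alpha> j. x j ^ k * (real (\<alpha> j choose k) * y j ^ (\<alpha> j - k)))"
    by (intro prod.cong refl, subst add.commute, subst binomial_ring) (auto intro!: sum.cong)
  also have "\<dots> = (\<Sum>\<beta>\<in>?B. \<Prod>j\<in>UNIV. x j ^ \<beta> j * (real (\<alpha> j choose \<beta> j) * y j ^ (\<alpha> j - \<beta> j)))"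
    by (rule prod_sum_PiE) auto
  finally show "(\<Prod>j\<in>UNIV. (y j + x j) ^ \<alpha> j)
      = (\<Sum>\<beta>\<in>?B. (\<Prod>j\<in>UNIV. x j ^ \<beta> j) * binomial_weight y \<alpha> \<beta>)"
    unfolding binomial_weight_def prod.distrib .
qed auto

text \<open>The formal Taylor coefficient at a of index \<beta>, obtained by expanding each (a +
  h)^\<alpha> and collecting h^\<beta>.\<close>

definition recenter_coeff ::
  "(('d::finite \<Rightarrow> nat) \<Rightarrow> 'a::real_normed_vector) \<Rightarrow> real ^ 'd \<Rightarrow> ('d \<Rightarrow> nat) \<Rightarrow> 'a" where
  "recenter_coeff c a \<beta> = (\<Sum>\<^sub>\<infinity>\<alpha>. binomial_weight (($) a) \<alpha> \<beta> *\<^sub>R c \<alpha>)"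

text \<open>The double series of the binomial expansions is summed in both orders. Fubini applies
  because the norms, summed over \<beta>, give the terms of an absolutely convergent series at a
  single point. The result yields both analyticity away from 0 and termwise differentiation.\<close>

lemma mpower_series_recenter:
  fixes c :: "('d::finite \<Rightarrow> nat) \<Rightarrow> 'a::banach"
  assumes "geometric_bound M \<rho> c" and small: "\<And>j. \<rho> * (\<bar>a $ j\<bar> + \<bar>h $ j\<bar>) < 1"
  shows "((\<lambda>\<beta>. monomial_at h \<beta> *\<^sub>R recenter_coeff c a \<beta>) has_sum mpower_series c (a + h)) UNIV"
proof -
  have "\<rho> > 0" using assms by (simp add: geometric_bound_def)
  define g where "g p = (monomial_at h (snd p) * binomial_weight (($) a) (fst p) (snd p)) *\<^sub>R c (fst p)" for p
  \<comment> \<open>The majorizing point: with all signs removed the binomial expansion sums exactly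
    to the monomial at \<open>t\<close>, and \<open>small\<close> places \<open>t\<close> in the
    polydisc of absolute convergence.\<close>
  define t :: "real ^ 'd" where "t = (\<chi> j. \<bar>a $ j\<bar> + \<bar>h $ j\<bar>)"
  have norm_sum: "((\<lambda>\<beta>. norm (g (\<alpha>, \<beta>))) has_sum norm (monomial_at t \<alpha> *\<^sub>R c \<alpha>)) UNIV" for \<alpha>
  proof -
    have "((\<lambda>\<beta>. ((\<Prod>j\<in>UNIV. \<bar>h $ j\<bar> ^ \<beta> j) * binomial_weight (\<lambda>j. \<bar>a $ j\<bar>) \<alpha> \<beta>) * norm (c \<alpha>)) has_sum
        (\<Prod>j\<in>UNIV. (\<bar>a $ j\<bar> + \<bar>h $ j\<bar>) ^ \<alpha> j) * norm (c \<alpha>)) UNIV"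
      by (intro has_sum_cmult_left multi_binomial)
    moreover have "norm (g (\<alpha>, \<beta>)) = ((\<Prod>j\<in>UNIV. \<bar>h $ j\<bar> ^ \<beta> j) * binomial_weight (\<lambda>j. \<bar>a $ j\<bar>) \<alpha> \<beta>) * norm (c \<alpha>)" for \<beta>
      by (simp add: g_def abs_mult abs_monomial_at binomial_weight_def abs_prod power_abs)
    moreover have "norm (monomial_at t \<alpha> *\<^sub>R c \<alpha>) = (\<Prod>j\<in>UNIV. (\<bar>a $ j\<bar> + \<bar>h $ j\<bar>) ^ \<alpha> j) * norm (c \<alpha>)"
      by (simp add: abs_monomial_at t_def)
    ultimately show ?thesis by (simp only:)
  qed
  have "(\<lambda>\<alpha>. norm (monomial_at t \<alpha> *\<^sub>R c \<alpha>)) summable_on UNIV"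
    by (rule geometric_bound_abs_summable[OF assms(1)]) (use small in \<open>simp add: t_def\<close>)
  then have abs_g: "(\<lambda>p. norm (g p)) summable_on (UNIV \<times> UNIV)"
    unfolding Infinite_Sum.abs_summable_on_Sigma_iff infsumI[OF norm_sum]
    using has_sum_imp_summable[OF norm_sum] by simp
  have abs_swapped: "(\<lambda>p. norm ((\<lambda>(\<beta>, \<alpha>). g (\<alpha>, \<beta>)) p)) summable_on (UNIV \<times> UNIV)"
    using abs_g by (subst (asm) summable_on_swap) (simp add: case_prod_unfold)
  from abs_g have "g summable_on (UNIV \<times> UNIV)" by (rule Infinite_Sum.abs_summable_summable)
  then obtain S where S: "(g has_sum S) (UNIV \<times> UNIV)" by (auto simp: summable_on_def)
  have "((\<lambda>\<beta>. g (\<alpha>, \<beta>)) has_sum monomial_at (a + h) \<alpha> *\<^sub>R c \<alpha>) UNIV" for \<alpha>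
    unfolding g_def monomial_at_def fst_conv snd_conv vector_add_component
    by (rule has_sum_bounded_linear[OF bounded_linear_scaleR_left multi_binomial])
  from has_sum_SigmaD[OF S this] have S_eq: "S = mpower_series c (a + h)"
    unfolding mpower_series_def by (simp add: infsumI)
  have swapped: "((\<lambda>(\<beta>, \<alpha>). g (\<alpha>, \<beta>)) has_sum S) (UNIV \<times> UNIV)"
    using S by (subst (asm) has_sum_swap)
  have "((\<lambda>\<alpha>. (\<lambda>(\<beta>, \<alpha>). g (\<alpha>, \<beta>)) (\<beta>, \<alpha>)) has_sum
      monomial_at h \<beta> *\<^sub>R recenter_coeff c a \<beta>) UNIV" for \<beta>
  proof -
    have "(\<lambda>\<alpha>. (\<lambda>(\<beta>, \<alpha>). g (\<alpha>, \<beta>)) (\<beta>, \<alpha>)) summable_on UNIV"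
      using abs_swapped[unfolded Infinite_Sum.abs_summable_on_Sigma_iff]
      by (elim conjE) (rule Infinite_Sum.abs_summable_summable, erule bspec, rule UNIV_I)
    then have "((\<lambda>\<alpha>. g (\<alpha>, \<beta>)) has_sum (\<Sum>\<^sub>\<infinity>\<alpha>. g (\<alpha>, \<beta>))) UNIV"
      unfolding prod.case by (rule has_sum_infsum)
    moreover have "(\<Sum>\<^sub>\<infinity>\<alpha>. g (\<alpha>, \<beta>)) = monomial_at h \<beta> *\<^sub>R recenter_coeff c a \<beta>"
      unfolding g_def recenter_coeff_def fst_conv snd_conv scaleR_scaleR[symmetric]
      by (rule infsum_scaleR_right)
    ultimately show ?thesis by (simp only: prod.case)
  qed
  from has_sum_SigmaD[OF swapped this] show ?thesis unfolding S_eq .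
qed

section \<open>Termwise differentiation and analyticity inside the ball of convergence\<close>

definition deriv_coeff ::
  "'d \<Rightarrow> (('d::finite \<Rightarrow> nat) \<Rightarrow> 'a::real_normed_vector) \<Rightarrow> ('d \<Rightarrow> nat) \<Rightarrow> 'a" where
  "deriv_coeff j c \<alpha> = real (Suc (\<alpha> j)) *\<^sub>R c (bump j \<alpha>)"

text \<open>The factor \<alpha>_j + 1 is at most 2^|\<alpha>| and is absorbed by doubling the rate;
  the additional degree of \<open>bump j \<alpha>\<close> costs one factor \<rho>. Half the radius
  is thus safe for derivative series.\<close>

lemma geometric_bound_deriv_coeff:
  fixes c :: "('d::finite \<Rightarrow> nat) \<Rightarrow> 'a::real_normed_vector"
  assumes "geometric_bound M \<rho> c"
  shows "geometric_bound (M * \<rho>) (2 * \<rho>) (deriv_coeff j c)"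
  unfolding geometric_bound_def
proof (intro conjI allI)
  show "0 < M * \<rho>" "0 < 2 * \<rho>" using assms by (auto simp: geometric_bound_def)
  fix \<alpha> :: "'d \<Rightarrow> nat"
  have "Suc (\<alpha> j) \<le> Suc (deg \<alpha>)" by (simp add: member_le_sum)
  also have "\<dots> \<le> 2 ^ deg \<alpha>" by (simp add: Suc_leI)
  finally have "real (Suc (\<alpha> j)) \<le> 2 ^ deg \<alpha>"
    by (metis numeral_power_le_of_nat_cancel_iff of_nat_le_iff of_nat_numeral of_nat_power)
  moreover have "norm (c (bump j \<alpha>)) \<le> M * \<rho> ^ Suc (deg \<alpha>)"
    using assms unfolding geometric_bound_def by (metis deg_bump)
  ultimately have "norm (deriv_coeff j c \<alpha>) \<le> 2 ^ deg \<alpha> * (M * \<rho> ^ Suc (deg \<alpha>))"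
    unfolding deriv_coeff_def norm_scaleR by (intro mult_mono) auto
  then show "norm (deriv_coeff j c \<alpha>) \<le> M * \<rho> * (2 * \<rho>) ^ deg \<alpha>"
    by (simp add: power_mult_distrib mult_ac)
qed

text \<open>The first-order Taylor coefficient at a is the formal derivative evaluated at a: terms
  with \<alpha>_j = 0 drop out, and the others are reindexed by \<open>bump j\<close>.\<close>

lemma recenter_coeff_unit:
  fixes c :: "('d::finite \<Rightarrow> nat) \<Rightarrow> 'a::real_normed_vector"
  shows "recenter_coeff c a (\<lambda>i. if i = j then 1 else 0) = mpower_series (deriv_coeff j c) a"
proof -
  let ?\<epsilon> = "\<lambda>i. if i = j then 1 else 0 :: nat"
  have "recenter_coeff c a ?\<epsilon> = (\<Sum>\<^sub>\<infinity>\<alpha>\<in>range (bump j). binomial_weight (($) a) \<alpha> ?\<epsilon> *\<^sub>R c \<alpha>)"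
    unfolding recenter_coeff_def
  proof (rule infsum_cong_neutral)
    fix \<alpha> :: "'d \<Rightarrow> nat" assume "\<alpha> \<in> UNIV - range (bump j)"
    then have "\<alpha> j = 0" by (simp add: range_bump)
    then have "real (\<alpha> j choose ?\<epsilon> j) * (a $ j) ^ (\<alpha> j - ?\<epsilon> j) = 0" by simp
    then have "binomial_weight (($) a) \<alpha> ?\<epsilon> = 0"
      unfolding binomial_weight_def by (intro prod_zero bexI[of _ j]) simp_all
    then show "binomial_weight (($) a) \<alpha> ?\<epsilon> *\<^sub>R c \<alpha> = 0" by simp
  qed auto
  also have "\<dots> = (\<Sum>\<^sub>\<infinity>\<alpha>. binomial_weight (($) a) (bump j \<alpha>) ?\<epsilon> *\<^sub>R c (bump j \<alpha>))"
    by (simp add: infsum_reindex[OF inj_bump] o_def)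
  also have "\<dots> = mpower_series (deriv_coeff j c) a"
    unfolding mpower_series_def
  proof (rule infsum_cong)
    fix \<alpha> :: "'d \<Rightarrow> nat"
    have "binomial_weight (($) a) (bump j \<alpha>) ?\<epsilon>
        = (\<Prod>i\<in>UNIV. (if i = j then real (Suc (\<alpha> j)) else 1) * (a $ i) ^ \<alpha> i)"
      unfolding binomial_weight_def by (intro prod.cong) (auto simp: bump_apply)
    then have "binomial_weight (($) a) (bump j \<alpha>) ?\<epsilon> = real (Suc (\<alpha> j)) * monomial_at a \<alpha>"
      by (simp add: prod.distrib monomial_at_def)
    then show "binomial_weight (($) a) (bump j \<alpha>) ?\<epsilon> *\<^sub>R c (bump j \<alpha>) = monomial_at a \<alpha> *\<^sub>R deriv_coeff j c \<alpha>"
      by (simp add: deriv_coeff_def mult.commute)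
  qed
  finally show ?thesis .
qed

text \<open>Recentred at a and restricted to the direction j, the series is a one-variable power
  series whose linear coefficient is the derivative.\<close>

lemma mpower_series_has_partial_derivative:
  fixes c :: "('d::finite \<Rightarrow> nat) \<Rightarrow> 'a::banach"
  assumes "geometric_bound M \<rho> c" and small: "\<And>i. \<rho> * \<bar>a $ i\<bar> < 1"
  shows "((\<lambda>s. mpower_series c (a + axis j s)) has_vector_derivative
    mpower_series (deriv_coeff j c) a) (at 0)"
proof -
  have "\<rho> > 0" using assms by (simp add: geometric_bound_def)
  define b where "b = line_coeff (recenter_coeff c a) (axis j 1)"
  have b1: "b 1 = mpower_series (deriv_coeff j c) a"
    unfolding b_def line_coeff_axis by (rule recenter_coeff_unit)
  \<comment> \<open>Moving along axis j changes only the j-th component, so only its distance to the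
    boundary of the polydisc matters.\<close>
  define r where "r = 1 / \<rho> - \<bar>a $ j\<bar>"
  have "r > 0" using small[of j] \<open>\<rho> > 0\<close> by (simp add: r_def field_simps)
  have "(\<lambda>n. s ^ n *\<^sub>R b n) sums mpower_series c (a + axis j s)" if "\<bar>s\<bar> < r" for s
    unfolding b_def
  proof (rule line_coeff_sums)
    have "\<rho> * (\<bar>a $ i\<bar> + \<bar>axis j s $ i\<bar>) < 1" for i
      using small[of i] that \<open>\<rho> > 0\<close> by (auto simp: axis_def r_def field_simps)
    from mpower_series_recenter[OF assms(1) this]
    show "((\<lambda>\<alpha>. monomial_at (s *\<^sub>R axis j 1) \<alpha> *\<^sub>R recenter_coeff c a \<alpha>) has_sum
        mpower_series c (a + axis j s)) UNIV"
      by (simp add: axis_eq_scaleR[of j s])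
  qed
  from vector_powser_has_vector_derivative[OF \<open>r > 0\<close> this] show ?thesis
    by (simp only: b1)
qed

lemma component_small: "\<rho> * norm a < 1 \<Longrightarrow> \<rho> > 0 \<Longrightarrow> \<rho> * \<bar>a $ i\<bar> < 1" for \<rho> :: real
  using component_le_norm_cart[of a i] by (smt (verit) mult_left_mono)

lemma mpower_series_strongly_analytic_at:
  fixes c :: "('d::finite \<Rightarrow> nat) \<Rightarrow> 'e::chilbert_space"
  assumes "geometric_bound M \<rho> c" "\<rho> * norm a < 1"
  shows "strongly_analytic_at (mpower_series c) a"
  unfolding strongly_analytic_at_def
proof (intro exI conjI ballI)
  have "\<rho> > 0" using assms by (simp add: geometric_bound_def)
  then show "1 / \<rho> - norm a > 0" using assms(2) by (simp add: field_simps)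
  fix t assume "t \<in> ball a (1 / \<rho> - norm a)"
  then have t: "\<rho> * (norm a + norm (t - a)) < 1"
    using \<open>\<rho> > 0\<close> by (simp add: field_simps dist_norm norm_minus_commute)
  have "\<rho> * (\<bar>a $ j\<bar> + \<bar>(t - a) $ j\<bar>) < 1" for j
  proof -
    have "\<bar>a $ j\<bar> + \<bar>(t - a) $ j\<bar> \<le> norm a + norm (t - a)"
      by (intro add_mono component_le_norm_cart)
    then show ?thesis using t \<open>\<rho> > 0\<close> by (smt (verit) mult_left_mono)
  qed
  from mpower_series_recenter[OF assms(1) this]
  show "((\<lambda>\<alpha>. monomial_at (t - a) \<alpha> *\<^sub>R recenter_coeff c a \<alpha>) has_sum mpower_series c t) UNIV"
    by simp
qed

lemma mpower_series_0:
  fixes c :: "('d::finite \<Rightarrow> nat) \<Rightarrow> 'a::real_normed_vector"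
  shows "mpower_series c 0 = c (\<lambda>_. 0)"
proof -
  have "monomial_at 0 \<alpha> = (if \<alpha> = (\<lambda>_. 0) then 1 else 0)" for \<alpha> :: "'d \<Rightarrow> nat"
    by (auto simp: monomial_at_def zero_power prod_zero_iff fun_eq_iff)
  then have "((\<lambda>\<alpha>. monomial_at 0 \<alpha> *\<^sub>R c \<alpha>) has_sum c (\<lambda>_. 0)) UNIV"
    by (intro has_sum_finite_neutralI[where B = "{\<lambda>_. 0}"]) auto
  then show ?thesis by (simp add: mpower_series_def infsumI)
qed

lemma eventually_axis_in_ball:
  assumes "norm (a :: real ^ 'd::finite) < r"
  shows "\<forall>\<^sub>F s in nhds 0. norm (a + axis j s) < r"
proof -
  have "((\<lambda>s. norm (a + s *\<^sub>R axis j 1)) \<longlongrightarrow> norm a) (nhds 0)"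
    by (auto intro!: tendsto_eq_intros filterlim_ident)
  then have "\<forall>\<^sub>F s in nhds 0. norm (a + s *\<^sub>R axis j 1) < r"
    using assms by (rule order_tendstoD)
  then show ?thesis
    by (rule eventually_mono) (metis axis_eq_scaleR)
qed

lemma partial_derivative_local:
  fixes w :: "real ^ 'd::finite \<Rightarrow> 'a::banach"
  assumes "geometric_bound M \<rho> c" "\<rho> * norm h < 1" "norm h < r"
    and eq: "\<And>h. norm h < r \<Longrightarrow> w (a + h) = mpower_series c h"
  shows "((\<lambda>s. w (a + h + axis j s)) has_vector_derivative mpower_series (deriv_coeff j c) h) (at 0)"
proof -
  have "\<rho> > 0" using assms by (simp add: geometric_bound_def)
  \<comment> \<open>The filter is \<open>nhds 0\<close> and not \<open>at 0\<close>, since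
    transferring a derivative also needs agreement at s = 0.\<close>
  have ev: "\<forall>\<^sub>F s in nhds 0. mpower_series c (h + axis j s) = w (a + h + axis j s)"
    using eventually_axis_in_ball[OF assms(3), of j]
    by (rule eventually_mono) (simp add: eq add.assoc)
  have "((\<lambda>s. mpower_series c (h + axis j s)) has_vector_derivative mpower_series (deriv_coeff j c) h) (at 0)"
    using assms(2) \<open>\<rho> > 0\<close> by (intro mpower_series_has_partial_derivative[OF assms(1)] component_small)
  then show ?thesis
    unfolding has_vector_derivative_def
    by (rule has_derivative_transform_eventually)
      (use ev eventually_nhds_x_imp_x[OF ev] in \<open>auto simp: eventually_at_filter elim: eventually_mono\<close>)
qed

text \<open>Vanishing near 0 passes to each derivative series, whose coefficients of degree n are
  nonzero multiples of those of degree n + 1. The series, its bounds and the radius all change in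
  this step, so the induction generalizes over them.\<close>

lemma mpower_series_coeffs_zero:
  fixes c :: "('d::finite \<Rightarrow> nat) \<Rightarrow> 'a::banach"
  assumes "geometric_bound M \<rho> c" "r > 0" "\<And>h. norm h < r \<Longrightarrow> mpower_series c h = 0"
  shows "c \<alpha> = 0"
  using assms
proof (induction "deg \<alpha>" arbitrary: \<alpha> c M \<rho> r)
  case 0
  then have "\<alpha> = (\<lambda>_. 0)" by (simp add: fun_eq_iff)
  then show ?case using 0 by (metis mpower_series_0 norm_zero)
next
  case (Suc n)
  obtain j \<beta> where \<alpha>: "\<alpha> = bump j \<beta>" and "deg \<beta> = n"
    using Suc.hyps(2) by (metis deg_Suc_obtain)
  have "\<rho> > 0" using Suc.prems by (simp add: geometric_bound_def)
  define r' where "r' = min r (1 / \<rho>)"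
  have "r' > 0" using Suc.prems(2) \<open>\<rho> > 0\<close> by (simp add: r'_def)
  have "mpower_series (deriv_coeff j c) h = 0" if "norm h < r'" for h
  proof -
    have "((\<lambda>s. (\<lambda>_. 0) (0 + h + axis j s)) has_vector_derivative mpower_series (deriv_coeff j c) h) (at 0)"
      using that \<open>\<rho> > 0\<close> Suc.prems(3)
      by (intro partial_derivative_local[OF Suc.prems(1), where r = r]) (auto simp: r'_def field_simps)
    then show ?thesis by (metis has_vector_derivative_const vector_derivative_at)
  qed
  then have "deriv_coeff j c \<beta> = 0"
    using Suc.hyps(1) \<open>deg \<beta> = n\<close> geometric_bound_deriv_coeff[OF Suc.prems(1)] \<open>r' > 0\<close> by blast
  then show ?case by (simp add: \<alpha> deriv_coeff_def)
qed

section \<open>Uniqueness\<close>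

lemma has_sum_zero_coeffs_zero:
  fixes c :: "('d::finite \<Rightarrow> nat) \<Rightarrow> 'a::banach"
  assumes "r > 0" and "\<And>h. norm h < r \<Longrightarrow> ((\<lambda>\<alpha>. monomial_at h \<alpha> *\<^sub>R c \<alpha>) has_sum 0) UNIV"
  shows "c \<alpha> = 0"
proof -
  obtain M \<rho> where "geometric_bound M \<rho> c"
    using has_sum_imp_geometric_bound[OF \<open>r > 0\<close>, of c "\<lambda>_. 0"] assms(2) mem_ball_0 by metis
  moreover have "mpower_series c h = 0" if "norm h < r" for h
    using assms(2)[OF that] by (simp add: mpower_series_def infsumI)
  ultimately show ?thesis using mpower_series_coeffs_zero \<open>r > 0\<close> by blast
qed

text \<open>The identity theorem on the segment from z to t. The set \<open>Z\<close> collects the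
  parameters with w = 0 along the line nearby, so it is open by construction. It is closed because
  at a limit point the local expansion, restricted to the line, has accumulating zeros;
  connectedness of [0,1] concludes.\<close>

lemma strongly_analytic_vanish:
  fixes w :: "real ^ 'd::finite \<Rightarrow> 'e::chilbert_space"
  assumes "convex U" "strongly_analytic_on w U" "z \<in> U" "t \<in> U"
    and "r > 0" and vanish: "\<And>h. norm h < r \<Longrightarrow> w (z + h) = 0"
  shows "w t = 0"
proof -
  define \<phi> where "\<phi> s = w (z + s *\<^sub>R (t - z))" for s
  \<comment> \<open>Adding 1 to the denominator covers t = z without a case distinction.\<close>
  have scaled: "norm (s *\<^sub>R (t - z)) < q" if "\<bar>s\<bar> < q / (norm (t - z) + 1)" for s q
  proof -
    have "norm (s *\<^sub>R (t - z)) \<le> \<bar>s\<bar> * (norm (t - z) + 1)"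
      by (simp add: mult_left_mono)
    also have "\<dots> < q"
      using that by (simp add: pos_less_divide_eq add_nonneg_pos)
    finally show ?thesis .
  qed
  have pos: "q / (norm (t - z) + 1) > 0" if "q > 0" for q :: real
    using that by (simp add: add_nonneg_pos)
  have near: "\<forall>\<^sub>F s in nhds x. P s" if "q > 0" "\<And>s. \<bar>s\<bar> < q \<Longrightarrow> P (s + x)" for P q and x :: real
    unfolding eventually_nhds_metric using that(2)[of "_ - x"] \<open>q > 0\<close>
    by (intro exI[of _ q]) (auto simp: dist_real_def)
  define Z where "Z = {0..1} \<inter> {s. \<forall>\<^sub>F x in nhds s. \<phi> x = 0}"
  have "openin (top_of_set {0..1}) Z"
    unfolding Z_def
  proof (rule openin_open_Int)
    show "open {s. \<forall>\<^sub>F x in nhds s. \<phi> x = 0}"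
      unfolding open_subopen[of "{s. \<forall>\<^sub>F x in nhds s. \<phi> x = 0}"]
      by (auto simp: eventually_nhds)
  qed
  moreover have "closedin (top_of_set {0..1}) Z"
    unfolding closedin_limpt
  proof (intro conjI allI impI)
    show "Z \<subseteq> {0..1}" by (auto simp: Z_def)
    fix x assume x: "x islimpt Z \<and> x \<in> {0..1}"
    have "z + x *\<^sub>R (t - z) = (1 - x) *\<^sub>R z + x *\<^sub>R t" by (simp add: algebra_simps)
    then have "z + x *\<^sub>R (t - z) \<in> U"
      using x assms by (auto intro!: convexD)
    then have "strongly_analytic_at w (z + x *\<^sub>R (t - z))"
      using assms(2) by (simp add: strongly_analytic_on_def)
    then obtain c q M \<rho> where "q > 0" "geometric_bound M \<rho> c"
      and sums: "\<And>h. h \<in> ball 0 q \<Longrightarrow> ((\<lambda>\<alpha>. monomial_at h \<alpha> *\<^sub>R c \<alpha>) has_sum w (z + x *\<^sub>R (t - z) + h)) UNIV"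
      by (rule strongly_analytic_atE) (rule that)
    define b where "b = line_coeff c (t - z)"
    define q' where "q' = q / (norm (t - z) + 1)"
    have "q' > 0" unfolding q'_def by (rule pos[OF \<open>q > 0\<close>])
    have line: "(\<lambda>n. s ^ n *\<^sub>R b n) sums \<phi> (s + x)" if "\<bar>s\<bar> < q'" for s
    proof -
      have shift: "z + x *\<^sub>R (t - z) + s *\<^sub>R (t - z) = z + (s + x) *\<^sub>R (t - z)"
        by (simp add: scaleR_add_left)
      have "s *\<^sub>R (t - z) \<in> ball 0 q"
        using scaled[of s q] that by (simp add: q'_def)
      from line_coeff_sums[OF sums[OF this]] show ?thesis
        unfolding b_def \<phi>_def shift .
    qed
    have "\<exists>\<^sub>F s in at x. s \<in> Z"
      using x by (simp add: islimpt_iff_eventually frequently_def)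
    then have "\<exists>\<^sub>F s in at x. \<phi> s = 0"
      by (rule frequently_elim1) (auto simp: Z_def dest: eventually_nhds_x_imp_x)
    then have "\<exists>\<^sub>F s in at 0. \<phi> (s + x) = 0"
      unfolding frequently_def eventually_at_to_0[of _ x] .
    from vector_powser_coeffs_zero[OF \<open>q' > 0\<close> line this] have "b n = 0" for n .
    then have "\<phi> (s + x) = 0" if "\<bar>s\<bar> < q'" for s
      using line[OF that] by (auto dest: sums_unique2[OF _ sums_zero])
    from near[of q' "\<lambda>s. \<phi> s = 0", OF \<open>q' > 0\<close> this] show "x \<in> Z" using x by (simp add: Z_def)
  qed
  moreover have "0 \<in> Z"
  proof -
    have "\<phi> (s + 0) = 0" if "\<bar>s\<bar> < r / (norm (t - z) + 1)" for s
      unfolding \<phi>_def using vanish scaled[OF that] by simp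
    from near[of _ "\<lambda>s. \<phi> s = 0", OF pos[OF \<open>r > 0\<close>] this] show ?thesis by (simp add: Z_def)
  qed
  ultimately have "Z = {0..1}"
    using connected_Icc[of "0::real" 1] unfolding connected_clopen by blast
  then have "1 \<in> Z" by simp
  then have "\<forall>\<^sub>F x in nhds 1. \<phi> x = 0" by (simp add: Z_def)
  then have "\<phi> 1 = 0" by (rule eventually_nhds_x_imp_x)
  then show ?thesis by (simp add: \<phi>_def)
qed

lemma partial_deriv_eqI:
  "((\<lambda>s. u (t + axis j s)) has_vector_derivative D) (at 0) \<Longrightarrow> partial_deriv u j t = D"
  unfolding partial_deriv_def by (rule vector_derivative_at)

text \<open>Provides one radius on which w and all its first partial derivatives have their
  expansions. Differentiability is included because \<open>partial_deriv\<close> is additive only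
  where the derivatives exist.\<close>

lemma strongly_analytic_at_0_local:
  fixes w :: "real ^ 'd::finite \<Rightarrow> 'e::chilbert_space"
  assumes "strongly_analytic_at w 0"
  obtains c r where "r > 0"
    "\<And>h. norm h < r \<Longrightarrow> ((\<lambda>\<alpha>. monomial_at h \<alpha> *\<^sub>R c \<alpha>) has_sum w h) UNIV"
    "\<And>h j. norm h < r \<Longrightarrow> ((\<lambda>\<alpha>. monomial_at h \<alpha> *\<^sub>R deriv_coeff j c \<alpha>) has_sum partial_deriv w j h) UNIV"
    "\<And>h j. norm h < r \<Longrightarrow> (\<lambda>s. w (h + axis j s)) differentiable (at 0)"
proof -
  obtain c r0 M \<rho> where "r0 > 0" and bound: "geometric_bound M \<rho> c"
    and sums: "\<And>h. h \<in> ball 0 r0 \<Longrightarrow> ((\<lambda>\<alpha>. monomial_at h \<alpha> *\<^sub>R c \<alpha>) has_sum w (0 + h)) UNIV"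
    using assms by (rule strongly_analytic_atE) blast
  have "\<rho> > 0" using bound by (simp add: geometric_bound_def)
  \<comment> \<open>The derivative series has growth rate 2 \<rho>.\<close>
  define r where "r = min r0 (1 / (2 * \<rho>))"
  have "r > 0" using \<open>r0 > 0\<close> \<open>\<rho> > 0\<close> by (simp add: r_def)
  have eq: "w (0 + h) = mpower_series c h" if "norm h < r0" for h
    using sums[of h] that by (simp add: mpower_series_def infsumI)
  have deriv: "((\<lambda>s. w (h + axis j s)) has_vector_derivative mpower_series (deriv_coeff j c) h) (at 0)"
    if "norm h < r" for h j
  proof -
    have "((\<lambda>s. w (0 + h + axis j s)) has_vector_derivative mpower_series (deriv_coeff j c) h) (at 0)"
      using that \<open>\<rho> > 0\<close> by (intro partial_derivative_local[OF bound _ _ eq]) (auto simp: r_def field_simps)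
    then show ?thesis by simp
  qed
  have sums': "((\<lambda>\<alpha>. monomial_at h \<alpha> *\<^sub>R deriv_coeff j c \<alpha>) has_sum partial_deriv w j h) UNIV"
    if "norm h < r" for h j
  proof -
    have "(2 * \<rho>) * norm h < 1" using that \<open>\<rho> > 0\<close> by (simp add: r_def field_simps)
    then have "((\<lambda>\<alpha>. monomial_at h \<alpha> *\<^sub>R deriv_coeff j c \<alpha>) has_sum mpower_series (deriv_coeff j c) h) UNIV"
      using \<open>\<rho> > 0\<close>
      by (intro geometric_bound_has_sum[OF geometric_bound_deriv_coeff[OF bound]] component_small) auto
    then show ?thesis by (simp only: partial_deriv_eqI[OF deriv[OF that]])
  qed
  show ?thesis
  proof (rule that[OF \<open>r > 0\<close> _ sums'])
    show "((\<lambda>\<alpha>. monomial_at h \<alpha> *\<^sub>R c \<alpha>) has_sum w h) UNIV" if "norm h < r" for h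
      using sums[of h] that by (simp add: r_def)
    show "(\<lambda>s. w (h + axis j s)) differentiable (at 0)" if "norm h < r" for h j
      using deriv[OF that] by (rule differentiableI_vector)
  qed
qed

text \<open>Applied to the difference of two solutions. Comparing coefficients in the equations
  gives a recursion that trades one power of t_k for at most one power of t_1, and the pure powers
  of t_1 are fixed by the initial condition.\<close>

lemma local_uniqueness:
  fixes w :: "real ^ 'd::finite \<Rightarrow> 'e::chilbert_space"
  assumes "strongly_analytic_at w 0"
    and P: "\<And>k. bounded_linear (P k)" and Q: "\<And>k. bounded_linear (Q k)"
    and "r > 0"
    and eqs: "\<And>h k. norm h < r \<Longrightarrow> partial_deriv w k h = P k (partial_deriv w e h) + Q k (w h)"
    and init: "\<And>s. \<bar>s\<bar> < r \<Longrightarrow> w (axis e s) = 0"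
  obtains r' where "r' > 0" "\<And>h. norm h < r' \<Longrightarrow> w h = 0"
proof -
  obtain c r0 where "r0 > 0"
    and sums: "\<And>h. norm h < r0 \<Longrightarrow> ((\<lambda>\<alpha>. monomial_at h \<alpha> *\<^sub>R c \<alpha>) has_sum w h) UNIV"
    and dsums: "\<And>h j. norm h < r0 \<Longrightarrow> ((\<lambda>\<alpha>. monomial_at h \<alpha> *\<^sub>R deriv_coeff j c \<alpha>) has_sum partial_deriv w j h) UNIV"
    using assms(1) by (rule strongly_analytic_at_0_local) blast
  define r1 where "r1 = min r r0"
  have "r1 > 0" using \<open>r > 0\<close> \<open>r0 > 0\<close> by (simp add: r1_def)
  have rec: "deriv_coeff k c \<alpha> = P k (deriv_coeff e c \<alpha>) + Q k (c \<alpha>)" for k \<alpha>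
  proof -
    have "(deriv_coeff k c \<alpha> - (P k (deriv_coeff e c \<alpha>) + Q k (c \<alpha>))) = 0"
    proof (rule has_sum_zero_coeffs_zero[OF \<open>r1 > 0\<close>])
      fix h :: "real ^ 'd" assume h: "norm h < r1"
      have "((\<lambda>\<alpha>. P k (monomial_at h \<alpha> *\<^sub>R deriv_coeff e c \<alpha>) + Q k (monomial_at h \<alpha> *\<^sub>R c \<alpha>)) has_sum
          P k (partial_deriv w e h) + Q k (w h)) UNIV"
        using h by (intro has_sum_add has_sum_bounded_linear[OF P] has_sum_bounded_linear[OF Q] sums dsums)
          (simp_all add: r1_def)
      note combined = has_sum_bounded_linear[OF bounded_linear_minus[OF bounded_linear_ident] this]
      have "norm h < r0" using h by (simp add: r1_def)
      from has_sum_add[OF dsums[OF this, of k] combined]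
      have "((\<lambda>\<alpha>. monomial_at h \<alpha> *\<^sub>R deriv_coeff k c \<alpha> +
          - (P k (monomial_at h \<alpha> *\<^sub>R deriv_coeff e c \<alpha>) + Q k (monomial_at h \<alpha> *\<^sub>R c \<alpha>))) has_sum
          partial_deriv w k h + - (P k (partial_deriv w e h) + Q k (w h))) UNIV" .
      then show "((\<lambda>\<alpha>. monomial_at h \<alpha> *\<^sub>R (deriv_coeff k c \<alpha> - (P k (deriv_coeff e c \<alpha>) + Q k (c \<alpha>)))) has_sum 0) UNIV"
        using eqs[of h k] h
        by (simp add: r1_def linear_simps(5)[OF P] linear_simps(5)[OF Q] algebra_simps)
    qed
    then show ?thesis by simp
  qed
  have axis: "c (\<lambda>i. if i = e then n else 0) = 0" for n
  proof -
    have "(\<lambda>n. s ^ n *\<^sub>R line_coeff c (axis e 1) n) sums 0" if "\<bar>s\<bar> < r1" for s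
    proof (rule line_coeff_sums)
      show "((\<lambda>\<alpha>. monomial_at (s *\<^sub>R axis e 1) \<alpha> *\<^sub>R c \<alpha>) has_sum 0) UNIV"
        using sums[of "axis e s"] init[of s] that by (simp add: axis_eq_scaleR[of e s] r1_def)
    qed
    from vector_powser_coeffs_zero[OF \<open>r1 > 0\<close> this, of n] show ?thesis
      by (simp add: line_coeff_axis)
  qed
  have "c \<alpha> = 0" for \<alpha>
  \<comment> \<open>The total degree does not decrease in the recursion, as
    \<open>bump e \<beta>\<close> has the same degree as \<open>bump k \<beta>\<close>. The degree
    in the variables other than t_1 does.\<close>
  proof (induction "sum \<alpha> (- {e})" arbitrary: \<alpha>)
    case 0
    then have "\<alpha> = (\<lambda>i. if i = e then \<alpha> e else 0)" by auto
    then show ?case using axis by metis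
  next
    case (Suc n)
    have "\<exists>k\<in>- {e}. \<alpha> k \<noteq> 0"
    proof (rule ccontr)
      assume "\<not> ?thesis"
      then have "sum \<alpha> (- {e}) = 0" by (intro sum.neutral) blast
      with Suc.hyps(2) show False by (simp only: nat.distinct)
    qed
    then obtain k where k: "k \<in> - {e}" "\<alpha> k \<noteq> 0" by blast
    define \<beta> where "\<beta> = \<alpha>(k := \<alpha> k - 1)"
    have \<alpha>: "\<alpha> = bump k \<beta>" unfolding \<beta>_def using k by (intro bump_decr[symmetric]) simp
    have "sum \<alpha> (- {e}) = Suc (sum \<beta> (- {e}))"
    proof -
      have "sum (bump k \<beta>) (- {e}) = (\<Sum>i\<in>- {e}. \<beta> i + (if i = k then 1 else 0))"
        by (intro sum.cong) (auto simp: bump_apply)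
      then show ?thesis using k by (simp add: sum.distrib \<alpha>)
    qed
    then have "n = sum \<beta> (- {e})" using Suc.hyps(2) by simp
    moreover have "sum (bump e \<beta>) (- {e}) = sum \<beta> (- {e})"
      by (intro sum.cong) (auto simp: bump_apply)
    ultimately have "c \<beta> = 0" "c (bump e \<beta>) = 0" using Suc.hyps(1) by auto
    then have "deriv_coeff k c \<beta> = 0"
      by (simp add: rec[of k \<beta>]) (simp add: deriv_coeff_def linear_simps(3)[OF P] linear_simps(3)[OF Q])
    then show ?case by (simp add: \<alpha> deriv_coeff_def)
  qed
  then have "w h = 0" if "norm h < r0" for h
    using sums[OF that] by (simp add: has_sum_0 has_sum_unique)
  then show ?thesis using that \<open>r0 > 0\<close> by blast
qed

section \<open>The formal solution\<close>

lemma prod_fact_bump: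
  "(\<Prod>i\<in>UNIV. fact (bump j \<alpha> i)) = of_nat (Suc (\<alpha> j)) * (\<Prod>i\<in>UNIV. fact (\<alpha> i) :: 'a::{semiring_char_0,comm_semiring_1})"
  for j :: "'d::finite"
proof -
  have "(\<Prod>i\<in>UNIV. fact (bump j \<alpha> i) :: 'a) = (\<Prod>i\<in>UNIV. (if i = j then of_nat (Suc (\<alpha> j)) else 1) * fact (\<alpha> i))"
    by (intro prod.cong) (auto simp: bump_apply)
  then show ?thesis by (simp add: prod.distrib)
qed

text \<open>The multinomial coefficient |\<alpha>|!/\<alpha>! is at most d^|\<alpha>|. Some
  component is at least the average |\<alpha>|/d; lowering it by 1 divides \<alpha>! by \<alpha>_j
  and |\<alpha>|! by |\<alpha>| \<le> d \<alpha>_j.\<close>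

lemma fact_deg_le:
  fixes \<alpha> :: "'d::finite \<Rightarrow> nat"
  shows "fact (deg \<alpha>) \<le> CARD('d) ^ deg \<alpha> * (\<Prod>j\<in>UNIV. fact (\<alpha> j) :: nat)"
proof (induction "deg \<alpha>" arbitrary: \<alpha>)
  case 0
  then show ?case by simp
next
  case (Suc n)
  obtain j where j: "deg \<alpha> \<le> CARD('d) * \<alpha> j"
  proof (rule ccontr)
    assume "\<not> thesis"
    then have less: "CARD('d) * \<alpha> j < deg \<alpha>" for j using that not_le by blast
    have "CARD('d) * deg \<alpha> = (\<Sum>j\<in>UNIV. CARD('d) * \<alpha> j)" by (simp add: sum_distrib_left)
    also have "\<dots> < (\<Sum>j\<in>(UNIV :: 'd set). deg \<alpha>)"
      by (rule sum_strict_mono) (use less in auto)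
    finally show False by simp
  qed
  with Suc.hyps(2) have "\<alpha> j > 0" by (cases "\<alpha> j") auto
  define \<beta> where "\<beta> = \<alpha>(j := \<alpha> j - 1)"
  have \<alpha>: "\<alpha> = bump j \<beta>" unfolding \<beta>_def by (rule bump_decr[of \<alpha> j, OF \<open>\<alpha> j > 0\<close>, symmetric])
  have "deg \<beta> = n" using Suc.hyps(2) by (simp add: \<alpha>)
  have "fact (deg \<alpha>) = deg \<alpha> * fact (deg \<beta>)" by (simp add: \<alpha>)
  also have "\<dots> \<le> (CARD('d) * \<alpha> j) * (CARD('d) ^ deg \<beta> * (\<Prod>j\<in>UNIV. fact (\<beta> j)))"
    using Suc.hyps(1)[of \<beta>] \<open>deg \<beta> = n\<close> j by (intro mult_mono) auto
  also have "\<dots> = CARD('d) ^ deg \<alpha> * (\<alpha> j * (\<Prod>j\<in>UNIV. fact (\<beta> j)))"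
    by (simp add: \<alpha>)
  also have "\<alpha> j * (\<Prod>i\<in>UNIV. fact (\<beta> i)) = (\<Prod>i\<in>UNIV. fact (\<alpha> i))"
    unfolding \<alpha> prod_fact_bump by (simp add: bump_apply)
  finally show ?case .
qed

locale commuting_first_order =
  fixes P Q :: "'d::finite \<Rightarrow> 'e::banach \<Rightarrow> 'e" and e :: 'd
  assumes P: "bounded_linear (P k)" and Q: "bounded_linear (Q k)"
    and commute_P: "P j (P k x) = P k (P j x)"
    and commute_Q: "Q j (Q k x) = Q k (Q j x)"
    and commute_PQ: "P j (Q k x) + Q j (P k x) = P k (Q j x) + Q k (P j x)"
    and P_e: "P e x = x" and Q_e: "Q e x = 0"
begin

text \<open>The operator \<open>P\<^sub>k \<partial>/\<partial>t\<^sub>1 + Q\<^sub>k\<close>, acting on the coefficients of power series in \<open>t\<^sub>1\<close>.\<close>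

definition L :: "'d \<Rightarrow> (nat \<Rightarrow> 'e) \<Rightarrow> nat \<Rightarrow> 'e" where
  "L k g n = real (Suc n) *\<^sub>R P k (g (Suc n)) + Q k (g n)"

lemma L_commute: "L j (L k g) = L k (L j g)"
proof
  fix n
  \<comment> \<open>Grouped by \<open>g (n+2)\<close>, \<open>g (n+1)\<close> and
    \<open>g n\<close>, each group is symmetric in j and k by one of the commutation
    assumptions.\<close>
  have expand: "L j (L k g) n = (real (Suc n) * real (Suc (Suc n))) *\<^sub>R P j (P k (g (Suc (Suc n))))
      + real (Suc n) *\<^sub>R (P j (Q k (g (Suc n))) + Q j (P k (g (Suc n)))) + Q j (Q k (g n))" for j k
    unfolding L_def
    by (simp only: linear_simps(1,5)[OF P] linear_simps(1,5)[OF Q] scaleR_add_right scaleR_scaleR ac_simps)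
  show "L j (L k g) n = L k (L j g) n"
    unfolding expand by (simp only: commute_P[of j k] commute_Q[of j k] commute_PQ[of j k])
qed

sublocale comp_fun_commute L
  by unfold_locales (auto simp: L_commute)

text \<open>The index type carries no order, so the product of powers is a fold over a set; it is
  meaningful because the \<open>L k\<close> commute.\<close>

definition L_power :: "('d \<Rightarrow> nat) \<Rightarrow> (nat \<Rightarrow> 'e) \<Rightarrow> nat \<Rightarrow> 'e" where
  "L_power \<alpha> a = Finite_Set.fold (\<lambda>k. L k ^^ \<alpha> k) a UNIV"

text \<open>By commutation any index may be applied last in the fold. Choosing k leaves a fold over
  the other indices, on which \<open>bump k \<alpha>\<close> and \<alpha> agree.\<close>

lemma L_power_bump: "L_power (bump k \<alpha>) a = L k (L_power \<alpha> a)"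
proof -
  interpret powers: comp_fun_commute "\<lambda>j. L j ^^ \<beta> j" for \<beta> :: "'d \<Rightarrow> nat"
    by (rule comp_fun_commute_funpow)
  have split: "L_power \<beta> a = (L k ^^ \<beta> k) (Finite_Set.fold (\<lambda>j. L j ^^ \<beta> j) a (UNIV - {k}))" for \<beta>
    unfolding L_power_def by (rule powers.fold_rec) auto
  have "Finite_Set.fold (\<lambda>j. L j ^^ bump k \<alpha> j) a (UNIV - {k})
      = Finite_Set.fold (\<lambda>j. L j ^^ \<alpha> j) a (UNIV - {k})"
    by (rule Finite_Set.fold_cong[OF powers.comp_fun_commute_on_axioms powers.comp_fun_commute_on_axioms])
      (auto simp: bump_apply)
  then show ?thesis by (simp add: split[of "bump k \<alpha>"] split[of \<alpha>] bump_apply)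
qed

lemma L_power_0: "L_power (\<lambda>_. 0) a = a"
proof -
  have "Finite_Set.fold (\<lambda>_ x. x) a A = a" if "finite A" for A :: "'d set"
  proof -
    interpret identity: comp_fun_commute "\<lambda>(_ :: 'd) (x :: nat \<Rightarrow> 'e). x" by unfold_locales auto
    from that show ?thesis by induction (simp_all add: identity.fold_insert)
  qed
  then show ?thesis by (simp add: L_power_def id_def)
qed

lemma L_e: "L e g n = real (Suc n) *\<^sub>R g (Suc n)"
  by (simp add: L_def P_e Q_e)

text \<open>\<open>L e\<close> is differentiation in t_1, and this is the coefficient formula of the
  n-th derivative. For m = 0, division by n! returns \<open>a n\<close>, hence the initial
  condition.\<close>

lemma L_power_axis: "L_power (\<lambda>i. if i = e then n else 0) a m = (fact (n + m) / fact m) *\<^sub>R a (n + m)"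
proof (induction n arbitrary: m)
  case 0
  have "(\<lambda>i. if i = e then 0 else 0) = (\<lambda>_. 0 :: nat)" by auto
  then show ?case by (simp add: L_power_0)
next
  case (Suc n)
  have "(\<lambda>i. if i = e then Suc n else 0) = bump e (\<lambda>i. if i = e then n else 0)"
    by (auto simp: bump_apply)
  then show ?case
    by (simp add: L_power_bump L_e Suc.IH field_simps del: of_nat_Suc)
qed

definition solution_coeff :: "(nat \<Rightarrow> 'e) \<Rightarrow> ('d \<Rightarrow> nat) \<Rightarrow> 'e" where
  "solution_coeff a \<alpha> = (1 / (\<Prod>j\<in>UNIV. fact (\<alpha> j))) *\<^sub>R L_power \<alpha> a 0"

lemma deriv_solution_coeff:
  "deriv_coeff k (solution_coeff a) \<alpha> = (1 / (\<Prod>j\<in>UNIV. fact (\<alpha> j))) *\<^sub>R L k (L_power \<alpha> a) 0"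
  by (simp add: deriv_coeff_def solution_coeff_def prod_fact_bump L_power_bump del: of_nat_Suc)

lemma solution_coeff_rec:
  "deriv_coeff k (solution_coeff a) \<alpha> =
    P k (deriv_coeff e (solution_coeff a) \<alpha>) + Q k (solution_coeff a \<alpha>)"
  unfolding deriv_solution_coeff L_e
  by (simp add: L_def solution_coeff_def linear_simps(5)[OF P] linear_simps(5)[OF Q] scaleR_add_right)

lemma solution_coeff_axis: "solution_coeff a (\<lambda>i. if i = e then n else 0) = a n"
proof -
  have "(\<Prod>j\<in>UNIV. fact (if j = e then n else 0)) = (\<Prod>j\<in>UNIV. if j = e then fact n else 1 :: real)"
    by (intro prod.cong) auto
  then show ?thesis by (simp add: solution_coeff_def L_power_axis)
qed

text \<open>The factor \<open>(|\<alpha>| + n)! / n!\<close> absorbs the derivatives in \<open>L\<close>; dividing by \<open>\<alpha>!\<close> afterwards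
  leaves geometric growth.\<close>

lemma L_power_bound:
  assumes K: "K > 0" "\<And>k x. norm (P k x) \<le> K * norm x" "\<And>k x. norm (Q k x) \<le> K * norm x"
    and "M > 0" "R > 0" and a: "\<And>n. norm (a n) \<le> M * R ^ n"
  shows "norm (L_power \<alpha> a n) \<le> M * (fact (deg \<alpha> + n) / fact n) * (K * (R + 1)) ^ deg \<alpha> * R ^ n"
\<comment> \<open>The index n varies because \<open>L\<close> at n reads the coefficient n +
  1.\<close>
proof (induction "deg \<alpha>" arbitrary: \<alpha> n)
  case 0
  then have "\<alpha> = (\<lambda>_. 0)" by (simp add: fun_eq_iff)
  then show ?case using a by (simp add: L_power_0)
next
  case (Suc N)
  obtain k \<beta> where \<alpha>: "\<alpha> = bump k \<beta>" and \<beta>: "deg \<beta> = N"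
    using Suc.hyps(2) by (metis deg_Suc_obtain)
  \<comment> \<open>The cost of one step: K R from the \<open>P\<close> term, which reads the next
    coefficient, and K from the \<open>Q\<close> term.\<close>
  define B where "B = K * (R + 1)"
  have "B > 0" using K \<open>R > 0\<close> by (simp add: B_def)
  let ?g = "L_power \<beta> a"
  have IH: "norm (?g m) \<le> M * (fact (N + m) / fact m) * B ^ N * R ^ m" for m
    using Suc.hyps(1)[of \<beta> m] \<beta> by (simp add: B_def)
  have "norm (L_power \<alpha> a n) \<le> real (Suc n) * norm (P k (?g (Suc n))) + norm (Q k (?g n))"
    unfolding \<alpha> L_power_bump L_def by (rule norm_triangle_le) simp
  \<comment> \<open>The factor n + 1 cancels against (n + 1)! in the first term. In the second, (N +
    n)! is enlarged to (N + n + 1)!, so that both terms share one factor and add up to B.\<close>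
  also have "\<dots> \<le> real (Suc n) * (K * (M * (fact (N + Suc n) / fact (Suc n)) * B ^ N * R ^ Suc n))
      + K * (M * (fact (N + Suc n) / fact n) * B ^ N * R ^ n)"
  proof (intro add_mono mult_left_mono)
    show "norm (P k (?g (Suc n))) \<le> K * (M * (fact (N + Suc n) / fact (Suc n)) * B ^ N * R ^ Suc n)"
      using K(1) by (intro order_trans[OF K(2)] mult_left_mono IH) auto
    have "norm (Q k (?g n)) \<le> K * (M * (fact (N + n) / fact n) * B ^ N * R ^ n)"
      using K(1) by (intro order_trans[OF K(3)] mult_left_mono IH) auto
    also have "\<dots> \<le> K * (M * (fact (N + Suc n) / fact n) * B ^ N * R ^ n)"
      using K(1) \<open>M > 0\<close> \<open>R > 0\<close> \<open>B > 0\<close>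
      by (intro mult_left_mono mult_right_mono divide_right_mono fact_mono) auto
    finally show "norm (Q k (?g n)) \<le> K * (M * (fact (N + Suc n) / fact n) * B ^ N * R ^ n)" .
  qed simp
  also have "real (Suc n) * (K * (M * (fact (N + Suc n) / fact (Suc n)) * B ^ N * R ^ Suc n))
      = K * R * (M * (fact (N + Suc n) / fact n) * B ^ N * R ^ n)"
  proof -
    have "fact (Suc n) = real (Suc n) * fact n" by (rule fact_Suc)
    then show ?thesis by (simp add: field_simps del: of_nat_Suc fact_Suc)
  qed
  also have "K * R * (M * (fact (N + Suc n) / fact n) * B ^ N * R ^ n)
      + K * (M * (fact (N + Suc n) / fact n) * B ^ N * R ^ n)
      = M * (fact (deg \<alpha> + n) / fact n) * B ^ deg \<alpha> * R ^ n"
    by (simp add: \<alpha> \<beta> B_def algebra_simps del: fact_Suc)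
  finally show ?case unfolding B_def .
qed

lemma solution_coeff_geometric_bound:
  assumes "M > 0" "R > 0" "\<And>n. norm (a n) \<le> M * R ^ n"
  obtains \<rho> where "geometric_bound M \<rho> (solution_coeff a)"
proof -
  \<comment> \<open>One bound for all indices at once; the summand 1 makes it positive.\<close>
  define K where "K = 1 + (\<Sum>k\<in>UNIV. onorm (P k) + onorm (Q k))"
  have nonneg: "0 \<le> onorm (P k)" "0 \<le> onorm (Q k)" for k
    using P Q by (simp_all add: onorm_pos_le)
  have le: "onorm (P k) + onorm (Q k) \<le> K" for k
    using member_le_sum[of k UNIV "\<lambda>k. onorm (P k) + onorm (Q k)"] nonneg by (simp add: K_def)
  have "K > 0" unfolding K_def using nonneg by (intro add_pos_nonneg sum_nonneg) auto
  have boundP: "norm (P k x) \<le> K * norm x" for k x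
    by (rule order_trans[OF onorm[OF P]]) (use le[of k] nonneg[of k] in \<open>intro mult_right_mono; simp\<close>)
  have boundQ: "norm (Q k x) \<le> K * norm x" for k x
    by (rule order_trans[OF onorm[OF Q]]) (use le[of k] nonneg[of k] in \<open>intro mult_right_mono; simp\<close>)
  define B where "B = K * (R + 1)"
  have "B > 0" using \<open>K > 0\<close> \<open>R > 0\<close> by (simp add: B_def)
  have "norm (solution_coeff a \<alpha>) \<le> M * (CARD('d) * B) ^ deg \<alpha>" for \<alpha>
  proof -
    let ?F = "\<Prod>j\<in>UNIV. fact (\<alpha> j) :: real"
    have "?F > 0" by (intro prod_pos) auto
    have "norm (L_power \<alpha> a 0) \<le> M * fact (deg \<alpha>) * B ^ deg \<alpha>"
      using L_power_bound[OF \<open>K > 0\<close> boundP boundQ assms, of \<alpha> 0] by (simp add: B_def)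
    also have "\<dots> \<le> M * (CARD('d) ^ deg \<alpha> * ?F) * B ^ deg \<alpha>"
    proof (intro mult_left_mono mult_right_mono)
      have "real (fact (deg \<alpha>)) \<le> real (CARD('d) ^ deg \<alpha> * (\<Prod>j\<in>UNIV. fact (\<alpha> j)))"
        using fact_deg_le[of \<alpha>] of_nat_le_iff by blast
      then show "fact (deg \<alpha>) \<le> CARD('d) ^ deg \<alpha> * ?F" by simp
    qed (use \<open>M > 0\<close> \<open>B > 0\<close> in auto)
    finally show ?thesis
      using \<open>?F > 0\<close> by (simp add: solution_coeff_def field_simps power_mult_distrib abs_of_pos)
  qed
  then have "geometric_bound M (CARD('d) * B) (solution_coeff a)"
    using \<open>M > 0\<close> \<open>B > 0\<close> by (simp add: geometric_bound_def)
  then show ?thesis by (rule that)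
qed

text \<open>The coefficient recursion is summed against the monomials. The factor 2 in the
  hypothesis is the doubled growth rate of the derivative series.\<close>

lemma mpower_series_solution_coeff:
  assumes bound: "geometric_bound M \<rho> (solution_coeff a)" and h: "(2 * \<rho>) * norm h < 1"
  shows "((\<lambda>s. mpower_series (solution_coeff a) (h + axis k s)) has_vector_derivative
    mpower_series (deriv_coeff k (solution_coeff a)) h) (at 0)"
    and "mpower_series (deriv_coeff k (solution_coeff a)) h =
      P k (mpower_series (deriv_coeff e (solution_coeff a)) h) + Q k (mpower_series (solution_coeff a) h)"
proof -
  have "\<rho> > 0" using bound by (simp add: geometric_bound_def)
  have h': "\<rho> * norm h < 1"
  proof -
    have "0 \<le> \<rho> * norm h" using \<open>\<rho> > 0\<close> by simp
    then show ?thesis using h by linarith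
  qed
  show "((\<lambda>s. mpower_series (solution_coeff a) (h + axis k s)) has_vector_derivative
      mpower_series (deriv_coeff k (solution_coeff a)) h) (at 0)"
    by (rule mpower_series_has_partial_derivative[OF bound component_small[OF h' \<open>\<rho> > 0\<close>]])
  have dsum: "((\<lambda>\<alpha>. monomial_at h \<alpha> *\<^sub>R deriv_coeff j (solution_coeff a) \<alpha>) has_sum
      mpower_series (deriv_coeff j (solution_coeff a)) h) UNIV" for j
    using \<open>\<rho> > 0\<close>
    by (intro geometric_bound_has_sum[OF geometric_bound_deriv_coeff[OF bound]] component_small h) simp
  have "((\<lambda>\<alpha>. monomial_at h \<alpha> *\<^sub>R solution_coeff a \<alpha>) has_sum mpower_series (solution_coeff a) h) UNIV"
    by (rule geometric_bound_has_sum[OF bound component_small[OF h' \<open>\<rho> > 0\<close>]])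
  then have "((\<lambda>\<alpha>. P k (monomial_at h \<alpha> *\<^sub>R deriv_coeff e (solution_coeff a) \<alpha>) +
      Q k (monomial_at h \<alpha> *\<^sub>R solution_coeff a \<alpha>)) has_sum
      P k (mpower_series (deriv_coeff e (solution_coeff a)) h) + Q k (mpower_series (solution_coeff a) h)) UNIV"
    by (intro has_sum_add has_sum_bounded_linear[OF P] has_sum_bounded_linear[OF Q] dsum)
  then have "((\<lambda>\<alpha>. monomial_at h \<alpha> *\<^sub>R deriv_coeff k (solution_coeff a) \<alpha>) has_sum
      P k (mpower_series (deriv_coeff e (solution_coeff a)) h) + Q k (mpower_series (solution_coeff a) h)) UNIV"
    unfolding solution_coeff_rec[of k]
    by (simp only: linear_simps(5)[OF P] linear_simps(5)[OF Q] scaleR_add_right)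
  with dsum[of k] show "mpower_series (deriv_coeff k (solution_coeff a)) h =
      P k (mpower_series (deriv_coeff e (solution_coeff a)) h) + Q k (mpower_series (solution_coeff a) h)"
    by (rule has_sum_unique)
qed

end

section \<open>Input compatibility systems\<close>

lemma norm_scaleC: "norm (c *\<^sub>C x) = cmod c * norm (x :: 'a::complex_inner)"
proof -
  have "cinner x (c *\<^sub>C x) = cnj c * complex_of_real ((norm x)\<^sup>2)"
    by (subst cinner_commute) (simp add: cinner_scaleC_left cinner_self)
  then have "complex_of_real ((norm (c *\<^sub>C x))\<^sup>2) = complex_of_real ((cmod c * norm x)\<^sup>2)"
    unfolding cinner_self[symmetric] cinner_scaleC_left
    by (simp add: cinner_self power_mult_distrib complex_norm_square flip: of_real_power)
  then show ?thesis
    unfolding of_real_eq_iff by (simp add: power2_eq_iff_nonneg)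
qed

lemma bounded_linear_scaleC: "bounded_linear (scaleC c :: 'a::complex_inner \<Rightarrow> 'a)"
proof (rule bounded_linear_intro[where K = "cmod c"])
  show "c *\<^sub>C r *\<^sub>R x = r *\<^sub>R c *\<^sub>C x" for r and x :: 'a
    by (simp add: scaleR_scaleC scaleC_scaleC mult.commute)
qed (simp_all add: scaleC_add_right norm_scaleC mult.commute)

lemma strongly_analytic_at1_0E:
  assumes "strongly_analytic_at1 f 0"
  obtains a r M R where "r > 0" "M > 0" "R > 0" "\<And>n. norm (a n) \<le> M * R ^ n"
    "\<And>s. \<bar>s\<bar> < r \<Longrightarrow> (\<lambda>n. s ^ n *\<^sub>R a n) sums f s"
proof -
  obtain a r where "r > 0" and sums: "\<And>s. s \<in> ball 0 r \<Longrightarrow> (\<lambda>n. (s - 0) ^ n *\<^sub>R a n) sums f s"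
    using assms unfolding strongly_analytic_at1_def by blast
  define q where "q = r / 2"
  have q: "q > 0" "q < r" using \<open>r > 0\<close> by (auto simp: q_def)
  obtain M where "M > 0" "\<And>n. norm (a n) \<le> M / q ^ n"
    by (rule sums_imp_coeff_bound[OF q(1)]) (use sums[of q] q in auto)
  then have "norm (a n) \<le> M * (1 / q) ^ n" for n by (simp add: power_one_over)
  then show ?thesis
    using that[of r M "1 / q" a] \<open>r > 0\<close> \<open>M > 0\<close> q sums by simp
qed

text \<open>Pointwise algebra, with \<open>d k\<close> and \<open>y\<close> in the place of the
  partial derivatives and the value of u. Forward, S is applied to the equations of the pairs (e,k).
  Backward, the terms in \<open>d e\<close> cancel since \<sigma>_j S \<sigma>_k is symmetric in j
  and k, and the formula for \<gamma>_jk cancels the terms in \<open>y\<close>.\<close>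

lemma input_equations_iff:
  fixes \<sigma> :: "'d::finite \<Rightarrow> 'e::chilbert_space \<Rightarrow> 'e" and \<gamma> :: "'d \<Rightarrow> 'd \<Rightarrow> 'e \<Rightarrow> 'e"
  assumes S: "bounded_clinear S" "\<And>x. S (\<sigma> e x) = x" "\<And>x. \<sigma> e (S x) = x"
    and \<sigma>: "\<And>k. bounded_clinear (\<sigma> k)"
    and skew: "\<And>j k x. \<gamma> j k x = - \<gamma> k j x"
    and commute: "\<And>j k x. S (\<sigma> j (S (\<sigma> k x))) = S (\<sigma> k (S (\<sigma> j x)))"
    and \<gamma>: "\<And>j k x. \<gamma> j k x = \<sigma> j (S (\<gamma> e k x)) - \<sigma> k (S (\<gamma> e j x))"
  shows "(\<forall>j k. \<sigma> k (d j) - \<sigma> j (d k) + \<i> *\<^sub>C \<gamma> j k y = 0) \<longleftrightarrow>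
    (\<forall>k. d k = S (\<sigma> k (d e)) + \<i> *\<^sub>C S (\<gamma> e k y))"
proof
  have linS: "bounded_linear S" "\<And>c x. S (c *\<^sub>C x) = c *\<^sub>C S x"
    using S(1) by (auto simp: bounded_clinear_def)
  have lin\<sigma>: "bounded_linear (\<sigma> k)" "\<sigma> k (c *\<^sub>C x) = c *\<^sub>C \<sigma> k x" for k c x
    using \<sigma> by (auto simp: bounded_clinear_def)
  {
    assume eqs: "\<forall>j k. \<sigma> k (d j) - \<sigma> j (d k) + \<i> *\<^sub>C \<gamma> j k y = 0"
    show "\<forall>k. d k = S (\<sigma> k (d e)) + \<i> *\<^sub>C S (\<gamma> e k y)"
    proof
      fix k
      \<comment> \<open>The instance taken has \<open>e\<close> as first index and \<open>k\<close>
        as second.\<close>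
      have "\<sigma> e (d k) = \<sigma> k (d e) + \<i> *\<^sub>C \<gamma> e k y"
        using eqs[rule_format, of k e] by (simp add: algebra_simps)
      then have "S (\<sigma> e (d k)) = S (\<sigma> k (d e)) + \<i> *\<^sub>C S (\<gamma> e k y)"
        by (simp only: linear_simps(1)[OF linS(1)] linS(2))
      then show "d k = S (\<sigma> k (d e)) + \<i> *\<^sub>C S (\<gamma> e k y)" by (simp only: S(2))
    qed
  next
    assume "\<forall>k. d k = S (\<sigma> k (d e)) + \<i> *\<^sub>C S (\<gamma> e k y)"
    then have d: "\<sigma> j (d k) = \<sigma> j (S (\<sigma> k (d e))) + \<i> *\<^sub>C \<sigma> j (S (\<gamma> e k y))" for j k
      by (metis linear_simps(1)[OF lin\<sigma>(1)] lin\<sigma>(2))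
    have "\<sigma> j (S (\<sigma> k x)) = \<sigma> k (S (\<sigma> j x))" for j k x
      using commute S(3) by metis
    then have comm: "\<sigma> j (S (\<sigma> k (d e))) = \<sigma> k (S (\<sigma> j (d e)))" for j k .
    have \<gamma>jk: "\<i> *\<^sub>C \<gamma> j k y = \<i> *\<^sub>C \<sigma> j (S (\<gamma> e k y)) - \<i> *\<^sub>C \<sigma> k (S (\<gamma> e j y))" for j k
      by (simp only: \<gamma>[of j k y] linear_simps(2)[OF bounded_linear_scaleC])
    show "\<forall>j k. \<sigma> k (d j) - \<sigma> j (d k) + \<i> *\<^sub>C \<gamma> j k y = 0"
    proof (intro allI)
      fix j k
      show "\<sigma> k (d j) - \<sigma> j (d k) + \<i> *\<^sub>C \<gamma> j k y = 0"
        by (simp add: d[of k j] d[of j k] comm[of j k] \<gamma>jk[of j k])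
    qed
  }
qed

lemma first_order_exists:
  fixes P Q :: "'d::finite \<Rightarrow> 'e::chilbert_space \<Rightarrow> 'e"
  assumes "commuting_first_order P Q e" and "strongly_analytic_at1 f 0"
  obtains r u where "r > 0" "strongly_analytic_on u (ball 0 r)"
    "\<And>h k. h \<in> ball 0 r \<Longrightarrow> partial_deriv u k h = P k (partial_deriv u e h) + Q k (u h)"
    "\<And>s. \<bar>s\<bar> < r \<Longrightarrow> u (axis e s) = f s"
proof -
  interpret commuting_first_order P Q e by fact
  obtain a r0 M R where "r0 > 0" "M > 0" "R > 0" and a: "\<And>n. norm (a n) \<le> M * R ^ n"
    and sums: "\<And>s. \<bar>s\<bar> < r0 \<Longrightarrow> (\<lambda>n. s ^ n *\<^sub>R a n) sums f s"
    using assms(2) by (rule strongly_analytic_at1_0E) blast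
  obtain \<rho> where bound: "geometric_bound M \<rho> (solution_coeff a)"
    using solution_coeff_geometric_bound[OF \<open>M > 0\<close> \<open>R > 0\<close> a] by blast
  have "\<rho> > 0" using bound by (simp add: geometric_bound_def)
  \<comment> \<open>Here r0 is the range of the expansion of f, and 1/(2 \<rho>) makes the
    derivative series converge.\<close>
  define r where "r = min r0 (1 / (2 * \<rho>))"
  define u where "u = mpower_series (solution_coeff a)"
  have small: "(2 * \<rho>) * norm h < 1" "\<rho> * norm h < 1" if "norm h < r" for h :: "real ^ 'd"
  proof -
    show *: "(2 * \<rho>) * norm h < 1" using that \<open>\<rho> > 0\<close> by (simp add: r_def field_simps)
    have "0 \<le> \<rho> * norm h" using \<open>\<rho> > 0\<close> by simp
    with * show "\<rho> * norm h < 1" by linarith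
  qed
  show ?thesis
  proof (rule that[of r u])
    show "r > 0" using \<open>r0 > 0\<close> \<open>\<rho> > 0\<close> by (simp add: r_def)
    show "strongly_analytic_on u (ball 0 r)"
      unfolding strongly_analytic_on_def u_def
      by (auto intro: mpower_series_strongly_analytic_at[OF bound small(2)])
    fix h :: "real ^ 'd" and k assume "h \<in> ball 0 r"
    then have h: "(2 * \<rho>) * norm h < 1" using small(1) by simp
    note deriv = mpower_series_solution_coeff(1)[OF bound h, folded u_def]
    show "partial_deriv u k h = P k (partial_deriv u e h) + Q k (u h)"
      unfolding partial_deriv_eqI[OF deriv] unfolding u_def by (rule mpower_series_solution_coeff(2)[OF bound h])
  next
    fix s :: real assume s: "\<bar>s\<bar> < r"
    have "\<rho> * norm (axis e s :: real ^ 'd) < 1"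
      by (rule small(2)) (use s in \<open>simp add: axis_eq_scaleR[of e s]\<close>)
    then have "((\<lambda>\<alpha>. monomial_at (s *\<^sub>R axis e 1) \<alpha> *\<^sub>R solution_coeff a \<alpha>) has_sum u (axis e s)) UNIV"
      unfolding u_def axis_eq_scaleR[of e s, symmetric]
      by (intro geometric_bound_has_sum[OF bound] component_small \<open>\<rho> > 0\<close>)
    from line_coeff_sums[OF this] have "(\<lambda>n. s ^ n *\<^sub>R a n) sums u (axis e s)"
      by (simp add: line_coeff_axis solution_coeff_axis)
    then show "u (axis e s) = f s"
      using sums[of s] s by (auto simp: r_def intro: sums_unique2)
  qed
qed

section \<open>The difference of two solutions\<close>

lemma strongly_analytic_at_diff:
  assumes "strongly_analytic_at u a" "strongly_analytic_at v a"
  shows "strongly_analytic_at (\<lambda>t. u t - v t) a"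
proof -
  obtain c r where c: "r > 0" "\<forall>t\<in>ball a r. ((\<lambda>\<alpha>. monomial_at (t - a) \<alpha> *\<^sub>R c \<alpha>) has_sum u t) UNIV"
    using assms(1) unfolding strongly_analytic_at_def by blast
  obtain d q where d: "q > 0" "\<forall>t\<in>ball a q. ((\<lambda>\<alpha>. monomial_at (t - a) \<alpha> *\<^sub>R d \<alpha>) has_sum v t) UNIV"
    using assms(2) unfolding strongly_analytic_at_def by blast
  have "((\<lambda>\<alpha>. monomial_at (t - a) \<alpha> *\<^sub>R (c \<alpha> - d \<alpha>)) has_sum u t - v t) UNIV"
    if "t \<in> ball a (min r q)" for t
  proof -
    have "((\<lambda>\<alpha>. monomial_at (t - a) \<alpha> *\<^sub>R c \<alpha> + - (monomial_at (t - a) \<alpha> *\<^sub>R d \<alpha>)) has_sum u t + - v t) UNIV"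
      by (intro has_sum_add has_sum_bounded_linear[OF bounded_linear_minus[OF bounded_linear_ident]])
        (use c d that in auto)
    then show ?thesis by (simp add: scaleR_diff_right)
  qed
  then show ?thesis
    unfolding strongly_analytic_at_def using c(1) d(1)
    by (intro exI[of _ "\<lambda>\<alpha>. c \<alpha> - d \<alpha>"] exI[of _ "min r q"]) auto
qed

lemma partial_deriv_diff:
  assumes "(\<lambda>s. u (t + axis j s)) differentiable (at 0)" "(\<lambda>s. v (t + axis j s)) differentiable (at 0)"
  shows "partial_deriv (\<lambda>t. u t - v t) j t = partial_deriv u j t - partial_deriv v j t"
  using assms unfolding partial_deriv_def vector_derivative_works
  by (intro vector_derivative_at has_vector_derivative_diff)

text \<open>The difference w vanishes near 0 by the recursion, and on the whole ball by the identity
  theorem along segments.\<close>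

lemma first_order_unique:
  fixes u v :: "real ^ 'd::finite \<Rightarrow> 'e::chilbert_space"
  assumes "r > 0" and u: "strongly_analytic_on u (ball 0 r)" and v: "strongly_analytic_on v (ball 0 r)"
    and P: "\<And>k. bounded_linear (P k)" and Q: "\<And>k. bounded_linear (Q k)"
    and equ: "\<And>h k. h \<in> ball 0 r \<Longrightarrow> partial_deriv u k h = P k (partial_deriv u e h) + Q k (u h)"
    and eqv: "\<And>h k. h \<in> ball 0 r \<Longrightarrow> partial_deriv v k h = P k (partial_deriv v e h) + Q k (v h)"
    and init: "\<And>s. \<bar>s\<bar> < r \<Longrightarrow> u (axis e s) = v (axis e s)"
    and t: "t \<in> ball 0 r"
  shows "u t = v t"
proof -
  define w where "w t = u t - v t" for t
  have w: "strongly_analytic_on w (ball 0 r)"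
    using u v unfolding strongly_analytic_on_def w_def by (blast intro: strongly_analytic_at_diff)
  have analytic0: "strongly_analytic_at u 0" "strongly_analytic_at v 0" "strongly_analytic_at w 0"
    using u v w \<open>r > 0\<close> by (simp_all add: strongly_analytic_on_def)
  obtain r1 where "r1 > 0" and r1: "\<And>h j. norm h < r1 \<Longrightarrow> (\<lambda>s. u (h + axis j s)) differentiable (at 0)"
    by (rule strongly_analytic_at_0_local[OF analytic0(1)]) blast
  obtain r2 where "r2 > 0" and r2: "\<And>h j. norm h < r2 \<Longrightarrow> (\<lambda>s. v (h + axis j s)) differentiable (at 0)"
    by (rule strongly_analytic_at_0_local[OF analytic0(2)]) blast
  \<comment> \<open>The equation for w is needed only near 0, where the expansions of u and v at 0
    guarantee that the partial derivatives exist and subtract.\<close>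
  define q where "q = min r (min r1 r2)"
  have "q > 0" using \<open>r > 0\<close> \<open>r1 > 0\<close> \<open>r2 > 0\<close> by (simp add: q_def)
  have eqw: "partial_deriv w k h = P k (partial_deriv w e h) + Q k (w h)" if "norm h < q" for h k
  proof -
    have "partial_deriv w j h = partial_deriv u j h - partial_deriv v j h" for j
      unfolding w_def by (rule partial_deriv_diff) (use that r1 r2 in \<open>auto simp: q_def\<close>)
    moreover have "h \<in> ball 0 r" using that by (simp add: q_def)
    ultimately show ?thesis
      using equ[of h k] eqv[of h k] by (simp add: w_def linear_simps(2)[OF P] linear_simps(2)[OF Q])
  qed
  have "w (axis e s) = 0" if "\<bar>s\<bar> < q" for s
    using init that by (simp add: w_def q_def)
  from local_uniqueness[OF analytic0(3) P Q \<open>q > 0\<close> eqw this]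
  obtain r' where "r' > 0" "\<And>h. norm h < r' \<Longrightarrow> w h = 0" by blast
  then have "w t = 0"
    using strongly_analytic_vanish[OF convex_ball w _ t, of 0 r'] \<open>r > 0\<close> by simp
  then show ?thesis by (simp add: w_def)
qed

theorem theorem3p6:
  fixes \<Phi> :: "'h::chilbert_space \<Rightarrow> 'e::chilbert_space"
    and A :: "'d::finite \<Rightarrow> 'h \<Rightarrow> 'h"
    and \<sigma> :: "'d \<Rightarrow> 'e \<Rightarrow> 'e"
    and \<gamma> \<gamma>s :: "'d \<Rightarrow> 'd \<Rightarrow> 'e \<Rightarrow> 'e"
    and e :: 'd  \<comment> \<open>the index \<open>1\<close>\<close>
    and f :: "real \<Rightarrow> 'e"
  assumes "vessel \<Phi> A \<sigma> \<gamma> \<gamma>s"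
    and "invertible_op (\<sigma> e)"
    and "\<And>j k. j \<noteq> e \<Longrightarrow> k \<noteq> e \<Longrightarrow>
      op_commutator (inv (\<sigma> e) \<circ> \<sigma> j) (inv (\<sigma> e) \<circ> \<sigma> k) = (\<lambda>x. 0)"
    and "\<And>j k. j \<noteq> e \<Longrightarrow> k \<noteq> e \<Longrightarrow>
      op_commutator (inv (\<sigma> e) \<circ> \<gamma> e j) (inv (\<sigma> e) \<circ> \<gamma> e k) = (\<lambda>x. 0)"
    and "\<And>j k. j \<noteq> e \<Longrightarrow> k \<noteq> e \<Longrightarrow>
      op_commutator (inv (\<sigma> e) \<circ> \<sigma> k) (inv (\<sigma> e) \<circ> \<gamma> e j) =
      op_commutator (inv (\<sigma> e) \<circ> \<sigma> j) (inv (\<sigma> e) \<circ> \<gamma> e k)"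
    and "\<And>j k. j \<noteq> e \<Longrightarrow> k \<noteq> e \<Longrightarrow>
      \<gamma> j k = (\<lambda>x. \<sigma> j (inv (\<sigma> e) (\<gamma> e k x)) - \<sigma> k (inv (\<sigma> e) (\<gamma> e j x)))"
    and "strongly_analytic_at1 f 0"
  shows "\<exists>U. open U \<and> 0 \<in> U \<and>
    (\<exists>u. analytic_solution_on \<sigma> \<gamma> e f U u \<and>
      (\<forall>v. analytic_solution_on \<sigma> \<gamma> e f U v \<longrightarrow> (\<forall>t\<in>U. v t = u t)))"
proof -
  interpret vessel \<Phi> A \<sigma> \<gamma> \<gamma>s by fact
  define S where "S = inv (\<sigma> e)"
  obtain S' where S': "bounded_clinear S'" "S' \<circ> \<sigma> e = id" "\<sigma> e \<circ> S' = id"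
    using assms(2) unfolding invertible_op_def by blast
  \<comment> \<open>The set-theoretic inverse is the bounded inverse given by
    \<open>invertible_op\<close>, so \<open>S\<close> is bounded and complex linear.\<close>
  have "S = S'" unfolding S_def using S' by (intro inv_unique_comp)
  then have S: "bounded_clinear S" "S (\<sigma> e x) = x" "\<sigma> e (S x) = x" for x
    using S' unfolding \<open>S = S'\<close> by (simp_all add: fun_eq_iff)
  have linS: "bounded_linear S" "S (c *\<^sub>C x) = c *\<^sub>C S x" for c x
    using S(1) by (auto simp: bounded_clinear_def)
  have lin: "bounded_linear (\<sigma> k)" "\<sigma> k (c *\<^sub>C x) = c *\<^sub>C \<sigma> k x"
    "bounded_linear (\<gamma> j k)" "\<gamma> j k (c *\<^sub>C x) = c *\<^sub>C \<gamma> j k x" for j k c x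
    using bounded_\<sigma> bounded_\<gamma> by (auto simp: bounded_clinear_def)
  have S0: "S 0 = 0" and \<sigma>0: "\<sigma> k 0 = 0" for k
    using linear_simps(3)[OF linS(1)] linear_simps(3)[OF lin(1)] by auto
  have \<gamma>ee: "\<gamma> e e x = 0" for x
  proof -
    have "2 *\<^sub>R \<gamma> e e x = 0" using skew_\<gamma>[of e e x] by (simp add: scaleR_2 eq_neg_iff_add_eq_0)
    then show ?thesis by simp
  qed
  \<comment> \<open>The hypotheses concern indices other than \<open>e\<close>. In this and the next
    three facts, an index equal to \<open>e\<close> is settled by S \<sigma>_e = \<sigma>_e S = id,
    by \<gamma>_ee = 0, or by the skew symmetry of \<gamma>.\<close>
  have commute_\<sigma>: "S (\<sigma> j (S (\<sigma> k x))) = S (\<sigma> k (S (\<sigma> j x)))" for j k x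
    using fun_cong[OF assms(3)[of j k], of x]
    by (cases "j = e \<or> k = e") (auto simp: S S_def[symmetric] op_commutator_def)
  have commute_\<gamma>: "S (\<gamma> e j (S (\<gamma> e k x))) = S (\<gamma> e k (S (\<gamma> e j x)))" for j k x
    using fun_cong[OF assms(4)[of j k], of x] linear_simps(3)[OF lin(3)]
    by (cases "j = e \<or> k = e") (auto simp: \<gamma>ee S0 S_def[symmetric] op_commutator_def)
  have commute_\<sigma>\<gamma>: "S (\<sigma> j (S (\<gamma> e k x))) + S (\<gamma> e j (S (\<sigma> k x))) =
      S (\<sigma> k (S (\<gamma> e j x))) + S (\<gamma> e k (S (\<sigma> j x)))" for j k x
    using fun_cong[OF assms(5)[of j k], of x]
    by (cases "j = e \<or> k = e")
      (auto simp: S S0 \<sigma>0 \<gamma>ee S_def[symmetric] op_commutator_def algebra_simps)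
  have \<gamma>: "\<gamma> j k x = \<sigma> j (S (\<gamma> e k x)) - \<sigma> k (S (\<gamma> e j x))" for j k x
    using fun_cong[OF assms(6)[of j k], of x] skew_\<gamma>[of j k x]
    by (cases "j = e \<or> k = e") (auto simp: S S0 \<sigma>0 \<gamma>ee S_def[symmetric])
  define P where "P k x = S (\<sigma> k x)" for k x
  define Q where "Q k x = \<i> *\<^sub>C S (\<gamma> e k x)" for k x
  have first_order: "commuting_first_order P Q e"
  proof (rule commuting_first_order.intro)
    show "bounded_linear (P k)" for k
      unfolding P_def[abs_def] by (rule bounded_linear_compose[OF linS(1) lin(1)])
    show "bounded_linear (Q k)" for k
      unfolding Q_def[abs_def]
      by (rule bounded_linear_compose[OF bounded_linear_scaleC bounded_linear_compose[OF linS(1) lin(3)]])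
    show "P j (P k x) = P k (P j x)" for j k x unfolding P_def by (rule commute_\<sigma>)
    show "Q j (Q k x) = Q k (Q j x)" for j k x
      unfolding Q_def lin linS by (simp only: commute_\<gamma>[of j k])
    show "P j (Q k x) + Q j (P k x) = P k (Q j x) + Q k (P j x)" for j k x
      unfolding P_def Q_def lin linS scaleC_add_right[symmetric] by (simp only: commute_\<sigma>\<gamma>[of j k])
    show "P e x = x" "Q e x = 0" for x
      by (simp_all add: P_def Q_def S \<gamma>ee S0 linear_simps(3)[OF bounded_linear_scaleC])
  qed
  then interpret commuting_first_order P Q e .
  have system: "input_system_on \<sigma> \<gamma> U u \<longleftrightarrow>
      (\<forall>h\<in>U. \<forall>k. partial_deriv u k h = P k (partial_deriv u e h) + Q k (u h))" for U u
    unfolding input_system_on_def P_def Q_def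
    using input_equations_iff[of S \<sigma> e \<gamma>, OF S bounded_\<sigma> skew_\<gamma> commute_\<sigma> \<gamma>] by simp
  obtain r u where "r > 0" and u: "strongly_analytic_on u (ball 0 r)"
    "\<And>h k. h \<in> ball 0 r \<Longrightarrow> partial_deriv u k h = P k (partial_deriv u e h) + Q k (u h)"
    "\<And>s. \<bar>s\<bar> < r \<Longrightarrow> u (axis e s) = f s"
    using first_order_exists[OF first_order assms(7)] by metis
  \<comment> \<open>The ball meets the t_1 axis exactly in |s| < r, the range on which u matches f.
    Its convexity serves uniqueness.\<close>
  have axis_in: "axis e s \<in> ball (0 :: real ^ 'd) r \<longleftrightarrow> \<bar>s\<bar> < r" for s
    by (simp add: axis_eq_scaleR[of e s])
  have "analytic_solution_on \<sigma> \<gamma> e f (ball 0 r) u"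
    unfolding analytic_solution_on_def system axis_in using u by blast
  moreover have "v t = u t" if "analytic_solution_on \<sigma> \<gamma> e f (ball 0 r) v" "t \<in> ball 0 r" for v t
  proof (rule first_order_unique[OF \<open>r > 0\<close> _ u(1) P Q _ u(2) _ that(2)])
    show "strongly_analytic_on v (ball 0 r)"
      using that(1) by (simp add: analytic_solution_on_def)
    show "partial_deriv v k h = P k (partial_deriv v e h) + Q k (v h)" if "h \<in> ball 0 r" for h k
      using \<open>analytic_solution_on \<sigma> \<gamma> e f (ball 0 r) v\<close> that
      unfolding analytic_solution_on_def system by blast
    show "v (axis e s) = u (axis e s)" if "\<bar>s\<bar> < r" for s
      using \<open>analytic_solution_on \<sigma> \<gamma> e f (ball 0 r) v\<close> that u(3)[OF that]
      unfolding analytic_solution_on_def axis_in by simp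
  qed
  ultimately show ?thesis
    using \<open>r > 0\<close> by (intro exI[of _ "ball 0 r"] conjI exI[of _ u]) auto
qed

end
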